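(* Let $H_1,H_2\in(0,1)\setminus\{\frac12\}$, $H=H_1+H_2\in(0,2)$, $H\ne1$, and let $Y=(Y^1,Y^2)$ be the bivariate fractional Ornstein–Uhlenbeck process. Let $(\Delta_n)$ be a sequence of positive numbers such that $\Delta_n\to0$ and $n\Delta_n\to+\infty$ as $n\to+\infty$, and let $$\tilde\rho_n=\frac1{\nu_1\nu_2n\Delta_n^H}\sum_{k=0}^{n-1}\big(Y^1_{(k+1)\Delta_n}-Y^1_{k\Delta_n}\big)\big(Y^2_{(k+1)\Delta_n}-Y^2_{k\Delta_n}\big).$$ Then $\tilde\rho_n\to\rho$ in $L^2(\mathbb P)$, and hence in probability, as $n\to+\infty$.
   Context: Bivariate fractional Brownian motion ($H=H_1+H_2\ne1$). $(B^{H_1}_t,B^{H_2}_t)_{t\in\mathbb R}$ is a centered Gaussian process such that each $B^{H_i}$ is a fractional Brownian motion on $\mathbb R$ with Hurst index $H_i$, $\mathrm{Var}(B^{H_i}_1)=1$, and for $i\ne j$ $$\mathbb E[B^{H_i}_tB^{H_j}_s]=\tfrac12\big((\rho+\mathrm{sign}(t)\eta_{ij})|t|^H+(\rho-\mathrm{sign}(s)\eta_{ij})|s|^H-(\rho-\mathrm{sign}(s-t)\eta_{ij})|s-t|^H\big),$$ with $\mathrm{sign}(x)=1$ for $x\ge0$, $-1$ for $x<0$; $\rho\in[-1,1]$ and $\eta_{12}=-\eta_{21}\in\mathbb R$ are such that this is a valid covariance. Bivariate fractional Ornstein–Uhlenbeck process: $Y^i_t=\nu_i\int_{-\infty}^te^{-\alpha_i(t-u)}dB^{H_i}_u$,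 $t\in\mathbb R$, $i=1,2$ (pathwise Riemann–Stieltjes integrals), with $\alpha_i,\nu_i>0$. *)

theory Defs
  imports "HOL-Probability.Probability"
begin

(* The second alternative of gaussian_rv admits the degenerate laws of variance 0. *)
definition gaussian_rv :: "'w measure \<Rightarrow> ('w \<Rightarrow> real) \<Rightarrow> bool" where
  "gaussian_rv M Z \<longleftrightarrow>
     Z \<in> borel_measurable M \<and>
     ((\<exists>m \<sigma>. \<sigma> > 0 \<and> distributed M lborel Z (normal_density m \<sigma>)) \<or>
      (\<exists>m. AE \<omega> in M. Z \<omega> = m))"

definition gaussian_process :: "'w measure \<Rightarrow> 'i set \<Rightarrow> ('i \<Rightarrow> 'w \<Rightarrow> real) \<Rightarrow> bool" where
  "gaussian_process M T X \<longleftrightarrow>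
     (\<forall>S c. finite S \<and> S \<subseteq> T \<longrightarrow> gaussian_rv M (\<lambda>\<omega>. \<Sum>i\<in>S. c i * X i \<omega>))"

definition centered_gaussian_process ::
    "'w measure \<Rightarrow> 'i set \<Rightarrow> ('i \<Rightarrow> 'w \<Rightarrow> real) \<Rightarrow> bool" where
  "centered_gaussian_process M T X \<longleftrightarrow>
     gaussian_process M T X \<and> (\<forall>i\<in>T. prob_space.expectation M (X i) = 0)"

(* Fractional Brownian motion indexed by the whole real line. Almost surely continuous paths are
   part of the definition; they are what makes pathwise Riemann-Stieltjes integrals against B
   meaningful. *)
definition fractional_brownian_motion ::
    "'w measure \<Rightarrow> real \<Rightarrow> (real \<Rightarrow> 'w \<Rightarrow> real) \<Rightarrow> bool" where
  "fractional_brownian_motion M H B \<longleftrightarrow>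
     centered_gaussian_process M UNIV B \<and>
     (\<forall>t s. prob_space.expectation M (\<lambda>\<omega>. B t \<omega> * B s \<omega>) =
        prob_space.variance M (B 1) / 2 *
        (\<bar>t\<bar> powr (2 * H) + \<bar>s\<bar> powr (2 * H) - \<bar>t - s\<bar> powr (2 * H))) \<and>
     (AE \<omega> in M. continuous_on UNIV (\<lambda>t. B t \<omega>))"

(* Unlike the library function sgn, sign0 takes the value 1 at 0. *)
definition sign0 :: "real \<Rightarrow> real" where
  "sign0 x = (if x \<ge> 0 then 1 else -1)"

(* The components of a bivariate process are B 1 and B 2; other indices are irrelevant. *)
definition bivariate_fbm ::
    "'w measure \<Rightarrow> (nat \<Rightarrow> real) \<Rightarrow> real \<Rightarrow> (nat \<Rightarrow> nat \<Rightarrow> real) \<Rightarrow> (nat \<Rightarrow> real \<Rightarrow> 'w \<Rightarrow> real) \<Rightarrow> bool"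
  where
  "bivariate_fbm M h \<rho> \<eta> B \<longleftrightarrow>
     centered_gaussian_process M ({1, 2} \<times> UNIV) (\<lambda>(i, t). B i t) \<and>
     (\<forall>i\<in>{1, 2}. fractional_brownian_motion M (h i) (B i) \<and>
        prob_space.variance M (B i 1) = 1) \<and>
     (\<forall>i\<in>{1, 2}. \<forall>j\<in>{1, 2}. i \<noteq> j \<longrightarrow> (\<forall>t s.
        prob_space.expectation M (\<lambda>\<omega>. B i t \<omega> * B j s \<omega>) =
        1 / 2 * ((\<rho> + sign0 t * \<eta> i j) * \<bar>t\<bar> powr (h 1 + h 2)
               + (\<rho> - sign0 s * \<eta> i j) * \<bar>s\<bar> powr (h 1 + h 2)
               - (\<rho> - sign0 (s - t) * \<eta> i j) * \<bar>s - t\<bar> powr (h 1 + h 2))))"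

(* The integral of f with respect to g over {a..b} exists and equals I. Fineness with respect to
   balls of a constant radius bounds the mesh of the division, so this is the Riemann-Stieltjes
   integral and not its gauge (Henstock) variant. *)
definition has_rs_integral ::
    "(real \<Rightarrow> real) \<Rightarrow> (real \<Rightarrow> real) \<Rightarrow> real \<Rightarrow> real \<Rightarrow> real \<Rightarrow> bool" where
  "has_rs_integral f g a b I \<longleftrightarrow>
     (\<forall>\<epsilon>>0. \<exists>\<delta>>0. \<forall>p. p tagged_division_of {a..b} \<and> (\<lambda>x. ball x \<delta>) fine p \<longrightarrow>
        \<bar>(\<Sum>(x, K)\<in>p. f x * (g (Sup K) - g (Inf K))) - I\<bar> < \<epsilon>)"

definition has_improper_rs_integral ::
    "(real \<Rightarrow> real) \<Rightarrow> (real \<Rightarrow> real) \<Rightarrow> real \<Rightarrow> real \<Rightarrow> bool" where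
  "has_improper_rs_integral f g b I \<longleftrightarrow>
     (\<exists>J. (\<forall>a\<le>b. has_rs_integral f g a b (J a)) \<and> (J \<longlongrightarrow> I) at_bot)"

(* Y t is \<nu> times the integral of exp (-\<alpha> (t - u)) dB_u over u in {..t}, outside one null set
   common to all t. *)
definition fractional_ornstein_uhlenbeck ::
    "'w measure \<Rightarrow> real \<Rightarrow> real \<Rightarrow> (real \<Rightarrow> 'w \<Rightarrow> real) \<Rightarrow> (real \<Rightarrow> 'w \<Rightarrow> real) \<Rightarrow> bool" where
  "fractional_ornstein_uhlenbeck M \<alpha> \<nu> B Y \<longleftrightarrow>
     (\<forall>t. Y t \<in> borel_measurable M) \<and>
     (AE \<omega> in M. \<forall>t. \<exists>I.
        has_improper_rs_integral (\<lambda>u. exp (- \<alpha> * (t - u))) (\<lambda>u. B u \<omega>) t I \<and>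
        Y t \<omega> = \<nu> * I)"

definition rho_estimator ::
    "(nat \<Rightarrow> real) \<Rightarrow> (nat \<Rightarrow> real) \<Rightarrow> (nat \<Rightarrow> real) \<Rightarrow> (nat \<Rightarrow> real \<Rightarrow> 'w \<Rightarrow> real) \<Rightarrow> nat \<Rightarrow> 'w \<Rightarrow> real" where
  "rho_estimator h \<nu> \<Delta> Y n \<omega> =
     1 / (\<nu> 1 * \<nu> 2 * real n * \<Delta> n powr (h 1 + h 2)) *
     (\<Sum>k<n. (Y 1 (real (k + 1) * \<Delta> n) \<omega> - Y 1 (real k * \<Delta> n) \<omega>)
            * (Y 2 (real (k + 1) * \<Delta> n) \<omega> - Y 2 (real k * \<Delta> n) \<omega>))"

definition square_integrable :: "'w measure \<Rightarrow> ('w \<Rightarrow> real) \<Rightarrow> bool" where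
  "square_integrable M Z \<longleftrightarrow> Z \<in> borel_measurable M \<and> integrable M (\<lambda>\<omega>. (Z \<omega>)\<^sup>2)"

definition converges_in_L2 ::
    "'w measure \<Rightarrow> (nat \<Rightarrow> 'w \<Rightarrow> real) \<Rightarrow> ('w \<Rightarrow> real) \<Rightarrow> bool" where
  "converges_in_L2 M X Z \<longleftrightarrow>
     (\<forall>n. square_integrable M (X n)) \<and> square_integrable M Z \<and>
     (\<lambda>n. prob_space.expectation M (\<lambda>\<omega>. (X n \<omega> - Z \<omega>)\<^sup>2)) \<longlonglongrightarrow> 0"

definition converges_in_probability ::
    "'w measure \<Rightarrow> (nat \<Rightarrow> 'w \<Rightarrow> real) \<Rightarrow> ('w \<Rightarrow> real) \<Rightarrow> bool" where
  "converges_in_probability M X Z \<longleftrightarrow>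
     (\<forall>n. X n \<in> borel_measurable M) \<and> Z \<in> borel_measurable M \<and>
     (\<forall>\<epsilon>>0. (\<lambda>n. measure M {\<omega> \<in> space M. \<bar>X n \<omega> - Z \<omega>\<bar> > \<epsilon>}) \<longlonglongrightarrow> 0)"

end

(* The Ornstein-Uhlenbeck equation gives Y^i_{t+d} - Y^i_t = nu_i (B^i_{t+d} - B^i_t) + r^i with a
   remainder r^i whose fourth moment is O(d^4) uniformly in t. This follows from Abel summation in the
   Riemann-Stieltjes sums of the integral, Jensen's inequality and Fatou's lemma, since the fourth
   moments of the increments of B^i grow only polynomially. As the increments of B^i are of order
   d^{H_i} with H_i < 1, the remainders contribute O(d^{1 - max H_i}) to the estimator in L^2.
   What is left is the empirical covariance of the increments of B, whose mean is rho exactly and whose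
   variance is, by Isserlis' formula and self-similarity, bounded by a Cesaro mean of products of second
   differences of the functions |x|^{2 H_i} and |x|^H, which vanish at infinity because the exponents
   are less than 2. *)
theory Submission
  imports Defs "HOL-Real_Asymp.Real_Asymp"
begin

section \<open>Gaussian moments\<close>

text \<open>The paths have unbounded variation, so estimating a Riemann-Stieltjes sum cell by cell
  diverges as the mesh shrinks. Summation by parts moves the differences onto the monotone
  exponential weight, whose total variation is bounded for every mesh; Jensen's inequality then
  needs only moments of increments of B from a fixed base point, and these depend on the distance
  alone, whence the uniformity in t. Divided by \<open>\<nu>\<close>, the remainder has two parts:
  an integral over \<open>[t, t + d]\<close> against the kernel minus 1, and
  \<open>- (1 - exp (- \<alpha> * d))\<close> times the integral over the whole past up to t. Both
  are of the order of \<open>1 - exp (- \<alpha> * d) \<le> \<alpha> * d\<close>, which gives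
  \<open>d ^ 4\<close>. The covariance function of Y never has to be computed. Fourth moments appear
  because a product of an increment and a remainder has to be small in L2. The remainder is reached
  only as an almost sure limit of sums, so its moments come from bounds on the sums that are uniform
  in the mesh and in the lower limit of integration.\<close>

definition centered_gaussian_rv :: "'w measure \<Rightarrow> ('w \<Rightarrow> real) \<Rightarrow> bool" where
  "centered_gaussian_rv M Z \<longleftrightarrow> gaussian_rv M Z \<and> prob_space.expectation M Z = 0"

context prob_space
begin

lemma gaussian_rv_integrable_power:
  assumes "gaussian_rv M Z"
  shows "integrable M (\<lambda>\<omega>. Z \<omega> ^ k)"
proof -
  have meas [measurable]: "Z \<in> borel_measurable M" using assms by (simp add: gaussian_rv_def)
  consider m \<sigma> where "\<sigma> > 0" "distributed M lborel Z (normal_density m \<sigma>)"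
    | m where "AE \<omega> in M. Z \<omega> = m"
    using assms unfolding gaussian_rv_def by auto
  then show ?thesis
  proof cases
    case 1
    have "integrable M (\<lambda>\<omega>. (Z \<omega> - m) ^ j)" for j
      using distributed_integrable[OF 1(2), of "\<lambda>x. (x - m) ^ j"] integrable_normal_moment[OF 1(1), of m j]
      by simp
    \<comment> \<open>The central moments are finite; the binomial expansion about the mean turns
      them into raw moments.\<close>
    then have "integrable M (\<lambda>\<omega>. \<Sum>j\<le>k. of_nat (k choose j) * (Z \<omega> - m) ^ j * m ^ (k - j))"
      by (intro Bochner_Integration.integrable_sum integrable_mult_left integrable_mult_right)
    moreover have "Z \<omega> ^ k = (\<Sum>j\<le>k. of_nat (k choose j) * (Z \<omega> - m) ^ j * m ^ (k - j))" for \<omega>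
      using binomial_ring[of "Z \<omega> - m" m k] by simp
    ultimately show ?thesis by simp
  next
    case 2
    have "integrable M (\<lambda>\<omega>. m ^ k)" by simp
    then show ?thesis
      by (rule integrable_cong_AE_imp) (use 2 in auto)
  qed
qed

lemma centered_gaussian_rv_fourth_moment:
  assumes "centered_gaussian_rv M Z"
  shows "expectation (\<lambda>\<omega>. Z \<omega> ^ 4) = 3 * (expectation (\<lambda>\<omega>. (Z \<omega>)\<^sup>2))\<^sup>2"
proof -
  have g: "gaussian_rv M Z" and e: "expectation Z = 0"
    using assms by (auto simp: centered_gaussian_rv_def)
  have meas [measurable]: "Z \<in> borel_measurable M" using g by (simp add: gaussian_rv_def)
  consider m \<sigma> where "\<sigma> > 0" "distributed M lborel Z (normal_density m \<sigma>)"
    | m where "AE \<omega> in M. Z \<omega> = m"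
    using g unfolding gaussian_rv_def by auto
  then show ?thesis
  proof cases
    case 1
    have "m = expectation Z"
      using distributed_integral[OF 1(2), of "\<lambda>x. x"] integral_normal_moment_nz_1[OF 1(1), of m]
      by simp
    then have m: "m = 0" using e by simp
    \<comment> \<open>The right side is \<sigma>^2 for j = 1 and 3 \<sigma>^4 for j = 2.\<close>
    have mom: "expectation (\<lambda>\<omega>. Z \<omega> ^ (2 * j)) = fact (2 * j) / ((2 / \<sigma>\<^sup>2) ^ j * fact j)" for j
      using distributed_integral[OF 1(2), of "\<lambda>x. x ^ (2 * j)"] integral_normal_moment_even[OF 1(1), of m j]
      by (simp add: m)
    show ?thesis
      using mom[of 1] mom[of 2] 1(1) by (simp add: fact_numeral field_simps power2_eq_square eval_nat_numeral)
  next
    case 2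
    have "expectation Z = expectation (\<lambda>\<omega>. m)"
      by (rule integral_cong_AE) (use 2 in auto)
    then have "m = 0" using e by (simp add: prob_space)
    with 2 have ae: "AE \<omega> in M. Z \<omega> = 0" by simp
    have "expectation (\<lambda>\<omega>. Z \<omega> ^ 4) = expectation (\<lambda>\<omega>. 0)"
      by (rule integral_cong_AE) (use ae in auto)
    moreover have "expectation (\<lambda>\<omega>. Z \<omega> ^ 2) = expectation (\<lambda>\<omega>. 0)"
      by (rule integral_cong_AE) (use ae in auto)
    ultimately show ?thesis by simp
  qed
qed

text \<open>Polarization: a product of four variables is a signed sum of fourth powers of linear
  combinations. Each combination is centered Gaussian, so its fourth moment is three times its
  squared variance, and the same signed sum of squared variances collapses to the three
  pairings.\<close>

lemma isserlis:
  assumes gauss: "\<And>p q r s. centered_gaussian_rv M (\<lambda>\<omega>. p * a \<omega> + q * b \<omega> + r * c \<omega> + s * d \<omega>)"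
  shows "integrable M (\<lambda>\<omega>. a \<omega> * b \<omega> * c \<omega> * d \<omega>)" (is ?int)
    and "expectation (\<lambda>\<omega>. a \<omega> * b \<omega> * c \<omega> * d \<omega>) =
      expectation (\<lambda>\<omega>. a \<omega> * b \<omega>) * expectation (\<lambda>\<omega>. c \<omega> * d \<omega>) +
      expectation (\<lambda>\<omega>. a \<omega> * c \<omega>) * expectation (\<lambda>\<omega>. b \<omega> * d \<omega>) +
      expectation (\<lambda>\<omega>. a \<omega> * d \<omega>) * expectation (\<lambda>\<omega>. b \<omega> * c \<omega>)" (is ?eq)
proof -
  define Z where "Z p q r s \<omega> = p * a \<omega> + q * b \<omega> + r * c \<omega> + s * d \<omega>" for p q r s \<omega>
  have gZ: "centered_gaussian_rv M (Z p q r s)" for p q r s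
    using gauss[of p q r s] by (simp add: Z_def[abs_def])
  have int: "integrable M (\<lambda>\<omega>. Z p q r s \<omega> ^ k)" for p q r s k
    using gZ gaussian_rv_integrable_power by (auto simp: centered_gaussian_rv_def)
  have sq: "integrable M (\<lambda>\<omega>. (a \<omega>)\<^sup>2)" "integrable M (\<lambda>\<omega>. (b \<omega>)\<^sup>2)"
    "integrable M (\<lambda>\<omega>. (c \<omega>)\<^sup>2)" "integrable M (\<lambda>\<omega>. (d \<omega>)\<^sup>2)"
    using int[of 1 0 0 0 2] int[of 0 1 0 0 2] int[of 0 0 1 0 2] int[of 0 0 0 1 2]
    by (simp_all add: Z_def)
  have pol2: "integrable M (\<lambda>\<omega>. x \<omega> * y \<omega>)"
    if "integrable M (\<lambda>\<omega>. (x \<omega>)\<^sup>2)" "integrable M (\<lambda>\<omega>. (y \<omega>)\<^sup>2)"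
      "integrable M (\<lambda>\<omega>. (x \<omega> + y \<omega>)\<^sup>2)" for x y :: "_ \<Rightarrow> real"
  proof -
    have "x \<omega> * y \<omega> = ((x \<omega> + y \<omega>)\<^sup>2 - (x \<omega>)\<^sup>2 - (y \<omega>)\<^sup>2) / 2" for \<omega>
      by (simp add: power2_eq_square algebra_simps)
    then have "(\<lambda>\<omega>. x \<omega> * y \<omega>) = (\<lambda>\<omega>. ((x \<omega> + y \<omega>)\<^sup>2 - (x \<omega>)\<^sup>2 - (y \<omega>)\<^sup>2) / 2)" by (rule ext)
    then show ?thesis using that by simp
  qed
  have "integrable M (\<lambda>\<omega>. a \<omega> * b \<omega>)" "integrable M (\<lambda>\<omega>. a \<omega> * c \<omega>)" "integrable M (\<lambda>\<omega>. a \<omega> * d \<omega>)"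
    "integrable M (\<lambda>\<omega>. b \<omega> * c \<omega>)" "integrable M (\<lambda>\<omega>. b \<omega> * d \<omega>)" "integrable M (\<lambda>\<omega>. c \<omega> * d \<omega>)"
    using int[of 1 1 0 0 2] int[of 1 0 1 0 2] int[of 1 0 0 1 2] int[of 0 1 1 0 2] int[of 0 1 0 1 2]
      int[of 0 0 1 1 2]
    by (auto simp: Z_def intro!: pol2 sq)
  note prods = this sq
  \<comment> \<open>The polarization on the side of the variances: \<open>A\<close> to
    \<open>D\<close> stand for the second moments of the four variables, which cancel, and
    \<open>ab\<close> to \<open>cd\<close> for the mixed moments.\<close>
  have polE: "(3 * (A + B + C + D + 2 * ab + 2 * ac + 2 * ad + 2 * bc + 2 * bd + 2 * cd)\<^sup>2
     - 3 * (A + B + C + D + 2 * ab + 2 * ac - 2 * ad + 2 * bc - 2 * bd - 2 * cd)\<^sup>2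
     - 3 * (A + B + C + D + 2 * ab - 2 * ac + 2 * ad - 2 * bc + 2 * bd - 2 * cd)\<^sup>2
     - 3 * (A + B + C + D - 2 * ab + 2 * ac + 2 * ad - 2 * bc - 2 * bd + 2 * cd)\<^sup>2
     + 3 * (A + B + C + D + 2 * ab - 2 * ac - 2 * ad - 2 * bc - 2 * bd + 2 * cd)\<^sup>2
     + 3 * (A + B + C + D - 2 * ab + 2 * ac - 2 * ad - 2 * bc + 2 * bd - 2 * cd)\<^sup>2
     + 3 * (A + B + C + D - 2 * ab - 2 * ac + 2 * ad + 2 * bc - 2 * bd - 2 * cd)\<^sup>2
     - 3 * (A + B + C + D - 2 * ab - 2 * ac - 2 * ad + 2 * bc + 2 * bd + 2 * cd)\<^sup>2) / 192
     = ab * cd + ac * bd + ad * bc" for A B C D ab ac ad bc bd cd :: real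
    by (simp add: power2_eq_square algebra_simps)
  have E2: "expectation (\<lambda>\<omega>. (Z p q r s \<omega>)\<^sup>2) =
      p\<^sup>2 * expectation (\<lambda>\<omega>. (a \<omega>)\<^sup>2) + q\<^sup>2 * expectation (\<lambda>\<omega>. (b \<omega>)\<^sup>2) +
      r\<^sup>2 * expectation (\<lambda>\<omega>. (c \<omega>)\<^sup>2) + s\<^sup>2 * expectation (\<lambda>\<omega>. (d \<omega>)\<^sup>2) +
      2 * p * q * expectation (\<lambda>\<omega>. a \<omega> * b \<omega>) + 2 * p * r * expectation (\<lambda>\<omega>. a \<omega> * c \<omega>) +
      2 * p * s * expectation (\<lambda>\<omega>. a \<omega> * d \<omega>) + 2 * q * r * expectation (\<lambda>\<omega>. b \<omega> * c \<omega>) +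
      2 * q * s * expectation (\<lambda>\<omega>. b \<omega> * d \<omega>) + 2 * r * s * expectation (\<lambda>\<omega>. c \<omega> * d \<omega>)" for p q r s
  proof -
    have "(Z p q r s \<omega>)\<^sup>2 = p\<^sup>2 * (a \<omega>)\<^sup>2 + q\<^sup>2 * (b \<omega>)\<^sup>2 + r\<^sup>2 * (c \<omega>)\<^sup>2 + s\<^sup>2 * (d \<omega>)\<^sup>2 +
      2 * p * q * (a \<omega> * b \<omega>) + 2 * p * r * (a \<omega> * c \<omega>) + 2 * p * s * (a \<omega> * d \<omega>) +
      2 * q * r * (b \<omega> * c \<omega>) + 2 * q * s * (b \<omega> * d \<omega>) + 2 * r * s * (c \<omega> * d \<omega>)" for \<omega>
      by (simp add: Z_def power2_eq_square algebra_simps)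
    then show ?thesis using prods by simp
  qed
  \<comment> \<open>Each fourth power is weighted by the product of its signs. Only the monomial
    abcd survives, with coefficient 4! in each of the 8 terms, and 8 * 24 = 192.\<close>
  have pol4: "a \<omega> * b \<omega> * c \<omega> * d \<omega> =
    (Z 1 1 1 1 \<omega> ^ 4 - Z 1 1 1 (-1) \<omega> ^ 4 - Z 1 1 (-1) 1 \<omega> ^ 4 - Z 1 (-1) 1 1 \<omega> ^ 4
     + Z 1 1 (-1) (-1) \<omega> ^ 4 + Z 1 (-1) 1 (-1) \<omega> ^ 4 + Z 1 (-1) (-1) 1 \<omega> ^ 4
     - Z 1 (-1) (-1) (-1) \<omega> ^ 4) / 192" for \<omega>
    unfolding Z_def by algebra
  show ?int unfolding pol4 by (intro integrable_divide Bochner_Integration.integrable_add Bochner_Integration.integrable_diff int)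
  show ?eq
    unfolding pol4 polE[symmetric, of "expectation (\<lambda>\<omega>. a \<omega> * b \<omega>)" "expectation (\<lambda>\<omega>. c \<omega> * d \<omega>)"
      _ _ _ _ "expectation (\<lambda>\<omega>. (a \<omega>)\<^sup>2)" "expectation (\<lambda>\<omega>. (b \<omega>)\<^sup>2)"
      "expectation (\<lambda>\<omega>. (c \<omega>)\<^sup>2)" "expectation (\<lambda>\<omega>. (d \<omega>)\<^sup>2)"]
    using int by (simp add: centered_gaussian_rv_fourth_moment[OF gZ] E2)
qed

end

section \<open>The linear span of a Gaussian process\<close>

definition process_span :: "'i set \<Rightarrow> ('i \<Rightarrow> 'w \<Rightarrow> real) \<Rightarrow> ('w \<Rightarrow> real) set" where
  "process_span T X = {\<lambda>\<omega>. \<Sum>i\<in>S. c i * X i \<omega> | S c. finite S \<and> S \<subseteq> T}"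

lemma process_span_base:
  assumes "i \<in> T" shows "X i \<in> process_span T X"
proof -
  have "X i = (\<lambda>\<omega>. \<Sum>j\<in>{i}. 1 * X j \<omega>)" by simp
  then show ?thesis unfolding process_span_def using assms
    by (intro CollectI exI[of _ "{i}"] exI[of _ "\<lambda>_. 1"]) simp
qed

lemma process_span_scale:
  assumes "Z \<in> process_span T X" shows "(\<lambda>\<omega>. r * Z \<omega>) \<in> process_span T X"
proof -
  obtain S c where *: "finite S" "S \<subseteq> T" "Z = (\<lambda>\<omega>. \<Sum>i\<in>S. c i * X i \<omega>)"
    using assms unfolding process_span_def by auto
  have "(\<lambda>\<omega>. r * Z \<omega>) = (\<lambda>\<omega>. \<Sum>i\<in>S. (r * c i) * X i \<omega>)"
    by (simp add: * sum_distrib_left mult.assoc)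
  then show ?thesis unfolding process_span_def using * by (intro CollectI exI[of _ S] exI[of _ "\<lambda>i. r * c i"]) simp
qed

lemma process_span_add:
  assumes "Z \<in> process_span T X" "W \<in> process_span T X"
  shows "(\<lambda>\<omega>. Z \<omega> + W \<omega>) \<in> process_span T X"
proof -
  obtain S c where *: "finite S" "S \<subseteq> T" "Z = (\<lambda>\<omega>. \<Sum>i\<in>S. c i * X i \<omega>)"
    using assms unfolding process_span_def by auto
  obtain S' c' where **: "finite S'" "S' \<subseteq> T" "W = (\<lambda>\<omega>. \<Sum>i\<in>S'. c' i * X i \<omega>)"
    using assms unfolding process_span_def by auto
  let ?c = "\<lambda>i. (if i \<in> S then c i else 0) + (if i \<in> S' then c' i else 0)"
  have "(\<Sum>i\<in>S \<union> S'. ?c i * X i \<omega>) =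
      (\<Sum>i\<in>S \<union> S'. if i \<in> S then c i * X i \<omega> else 0) + (\<Sum>i\<in>S \<union> S'. if i \<in> S' then c' i * X i \<omega> else 0)" for \<omega>
    by (subst sum.distrib[symmetric], intro sum.cong) (auto simp: algebra_simps)
  also have "\<dots> \<omega> = Z \<omega> + W \<omega>" for \<omega>
    using *(1) **(1) by (simp add: *(3) **(3) sum.inter_restrict[symmetric] Int_absorb1)
  finally have "(\<lambda>\<omega>. Z \<omega> + W \<omega>) = (\<lambda>\<omega>. \<Sum>i\<in>S \<union> S'. ?c i * X i \<omega>)" by simp
  then show ?thesis unfolding process_span_def using * **
    by (intro CollectI exI[of _ "S \<union> S'"] exI[of _ ?c]) simp
qed

lemma process_span_diff:
  assumes "Z \<in> process_span T X" "W \<in> process_span T X"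
  shows "(\<lambda>\<omega>. Z \<omega> - W \<omega>) \<in> process_span T X"
  using process_span_add[OF assms(1) process_span_scale[OF assms(2), of "-1"]] by simp

lemma process_span_sum:
  assumes "\<And>k. k \<in> K \<Longrightarrow> Z k \<in> process_span T X"
  shows "(\<lambda>\<omega>. \<Sum>k\<in>K. Z k \<omega>) \<in> process_span T X"
proof -
  have zero: "(\<lambda>\<omega>. 0) \<in> process_span T X"
    unfolding process_span_def by (intro CollectI exI[of _ "{}"]) simp
  show ?thesis using assms
    by (induction K rule: infinite_finite_induct) (auto simp: zero intro: process_span_add)
qed

lemmas process_span_intros =
  process_span_scale process_span_add process_span_diff process_span_sum

text \<open>Together with the closure rules this gives joint Gaussianity of increments without
  exhibiting index sets or coefficients.\<close>

lemma (in prob_space) process_span_centered_gaussian: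
  assumes "centered_gaussian_process M T X" "Z \<in> process_span T X"
  shows "centered_gaussian_rv M Z"
proof -
  obtain S c where *: "finite S" "S \<subseteq> T" "Z = (\<lambda>\<omega>. \<Sum>i\<in>S. c i * X i \<omega>)"
    using assms unfolding process_span_def by auto
  have g: "gaussian_rv M W" if "W \<in> process_span T X" for W
    using assms(1) that unfolding centered_gaussian_process_def gaussian_process_def process_span_def by auto
  have "integrable M (X i)" if "i \<in> S" for i
    using gaussian_rv_integrable_power[OF g[OF process_span_base], of i 1] that *(2) by auto
  then have "expectation Z = (\<Sum>i\<in>S. c i * expectation (X i))"
    unfolding *(3) by (subst Bochner_Integration.integral_sum) auto
  also have "\<dots> = 0"
    using assms(1) *(2) unfolding centered_gaussian_process_def by (intro sum.neutral) auto
  finally show ?thesis using g[OF assms(2)] by (simp add: centered_gaussian_rv_def)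
qed

section \<open>Riemann-Stieltjes sums of Ornstein-Uhlenbeck integrals\<close>

text \<open>The integral becomes a limit of explicit finite sums, which are measurable in the path
  and open to moment estimates. The grid is counted downwards from b because the lower limit a will
  later tend to minus infinity.\<close>

lemma has_rs_integral_uniform_sums:
  assumes I: "has_rs_integral f g a b I" and "a < b"
  shows "(\<lambda>m. \<Sum>i<m. f (b - real i * ((b - a) / real m)) *
      (g (b - real i * ((b - a) / real m)) - g (b - real (Suc i) * ((b - a) / real m)))) \<longlonglongrightarrow> I"
proof (rule LIMSEQ_I)
  fix \<epsilon> :: real assume "\<epsilon> > 0"
  then obtain \<delta> where "\<delta> > 0" and \<delta>: "\<And>p. p tagged_division_of {a..b} \<Longrightarrow> (\<lambda>x. ball x \<delta>) fine p \<Longrightarrow>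
        \<bar>(\<Sum>(x, K)\<in>p. f x * (g (Sup K) - g (Inf K))) - I\<bar> < \<epsilon>"
    using I unfolding has_rs_integral_def by meson
  have "(\<lambda>m. (b - a) / real m) \<longlonglongrightarrow> 0"
    by (rule lim_const_over_n)
  then have "\<forall>\<^sub>F m in sequentially. (b - a) / real m < \<delta>"
    using \<open>\<delta> > 0\<close> by (rule order_tendstoD)
  then obtain m0 where m0: "\<And>m. m \<ge> m0 \<Longrightarrow> (b - a) / real m < \<delta>"
    unfolding eventually_sequentially by auto
  show "\<exists>no. \<forall>m\<ge>no. norm ((\<Sum>i<m. f (b - real i * ((b - a) / real m)) *
      (g (b - real i * ((b - a) / real m)) - g (b - real (Suc i) * ((b - a) / real m)))) - I) < \<epsilon>"
  proof (intro exI allI impI)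
    \<comment> \<open>\<open>Suc\<close> excludes m = 0, where the step would be 0 by the convention
      for division by zero.\<close>
    fix m assume m: "Suc m0 \<le> m"
    define d where "d = (b - a) / real m"
    define u where "u i = b - real i * d" for i
    have d: "d > 0" "d < \<delta>" using m m0[of m] \<open>a < b\<close> by (auto simp: d_def)
    have um: "u m = a" and u0: "u 0 = b" using m by (auto simp: u_def d_def)
    have u_less: "u j < u i" if "i < j" for i j using that d by (simp add: u_def)
    have u_le: "u j \<le> u i" if "i \<le> j" for i j using that d by (simp add: u_def mult_right_mono)
    have uSuc: "u (Suc i) = u i - d" for i by (simp add: u_def algebra_simps)
    define K where "K i = {u (Suc i)..u i}" for i
    have un: "(\<Union>i<Suc n. K i) = {u (Suc n)..u 0}" for n
    proof (induction n)
      case (Suc n)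
      have "(\<Union>i<Suc (Suc n). K i) = K (Suc n) \<union> {u (Suc n)..u 0}"
        using Suc by (simp add: lessThan_Suc[of "Suc n"])
      also have "\<dots> = {u (Suc (Suc n))..u 0}"
        unfolding K_def by (rule ivl_disj_un_two_touch) (auto intro: u_le)
      finally show ?case .
    qed (simp add: K_def lessThan_Suc)
    let ?F = "\<lambda>i. (u i, K i)"
    have inj: "inj_on ?F {..<m}"
      by (intro inj_onI) (metis Pair_inject less_irrefl linorder_neqE_nat u_less)
    have tag: "?F ` {..<m} tagged_division_of {a..b}"
    proof (rule tagged_division_ofI)
      show "finite (?F ` {..<m})" by simp
      fix x L assume "(x, L) \<in> ?F ` {..<m}"
      then obtain i where i: "i < m" "x = u i" "L = K i" by auto
      show "x \<in> L" unfolding i K_def using u_le[of i "Suc i"] by simp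
      show "L \<subseteq> {a..b}" unfolding i K_def using u_le[of 0 i] u_le[of "Suc i" m] i um u0 by auto
      show "\<exists>a b. L = cbox a b" unfolding i K_def by auto
    next
      fix x1 K1 x2 K2
      assume "(x1, K1) \<in> ?F ` {..<m}" "(x2, K2) \<in> ?F ` {..<m}" "(x1, K1) \<noteq> (x2, K2)"
      then obtain i j where "x1 = u i" "x2 = u j" and ij: "K1 = K i" "K2 = K j" and "u i \<noteq> u j \<or> K i \<noteq> K j"
        by auto
      then have "i \<noteq> j" by auto
      have dis: "{u (Suc i)<..<u i} \<inter> {u (Suc j)<..<u j} = {}" if "i < j" for i j
        using u_le[of "Suc i" j] that by auto
      show "interior K1 \<inter> interior K2 = {}"
        unfolding ij K_def using dis[of i j] dis[of j i] \<open>i \<noteq> j\<close> by (cases i j rule: linorder_cases) auto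
    next
      obtain n where n: "m = Suc n" using m by (cases m) auto
      have "\<Union>{L. \<exists>x. (x, L) \<in> ?F ` {..<m}} = (\<Union>i<m. K i)" by auto
      then show "\<Union>{L. \<exists>x. (x, L) \<in> ?F ` {..<m}} = {a..b}" using un[of n] um u0 n by simp
    qed
    \<comment> \<open>The tag is the right end of a cell of length d < \<delta>, so the whole cell
      lies in the open ball.\<close>
    have fine: "(\<lambda>x. ball x \<delta>) fine ?F ` {..<m}"
      unfolding fine_def K_def using d by (auto simp: dist_real_def uSuc)
    have "(\<Sum>(x, L)\<in>?F ` {..<m}. f x * (g (Sup L) - g (Inf L))) = (\<Sum>i<m. f (u i) * (g (u i) - g (u (Suc i))))"
      by (subst sum.reindex[OF inj]) (auto simp: K_def u_le)
    with \<delta>[OF tag fine] show "norm ((\<Sum>i<m. f (b - real i * ((b - a) / real m)) *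
      (g (b - real i * ((b - a) / real m)) - g (b - real (Suc i) * ((b - a) / real m)))) - I) < \<epsilon>"
      by (simp add: u_def d_def)
  qed
qed

text \<open>The sums are taken from the right end \<open>t\<close> down to \<open>t - N \<delta>\<close>, with right-endpoint tags.\<close>

definition ou_sum :: "real \<Rightarrow> (real \<Rightarrow> real) \<Rightarrow> real \<Rightarrow> real \<Rightarrow> nat \<Rightarrow> real" where
  "ou_sum \<alpha> g t \<delta> N =
     (\<Sum>i<N. exp (- \<alpha> * (real i * \<delta>)) * (g (t - real i * \<delta>) - g (t - real (Suc i) * \<delta>)))"

text \<open>Among the uniform divisions of an interval of length \<open>Suc j * d\<close> only those
  into \<open>Suc j * Suc m\<close> cells are kept. Their mesh \<open>d / Suc m\<close> is
  independent of j, and d is a multiple of it.\<close>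

lemma ou_sum_limit:
  assumes I: "has_rs_integral (\<lambda>u. exp (- \<alpha> * (t - u))) g (t - real (Suc j) * d) t I" and d: "d > 0"
  shows "(\<lambda>m. ou_sum \<alpha> g t (d / real (Suc m)) (Suc j * Suc m)) \<longlonglongrightarrow> I"
proof -
  have "t - real (Suc j) * d < t" using d by simp
  note lim = has_rs_integral_uniform_sums[OF I this]
  have mono: "strict_mono (\<lambda>m. Suc j * Suc m)"
    by (rule strict_monoI) (simp only: mult_less_cancel1, simp)
  have *: "(t - (t - real (Suc j) * d)) / real (Suc j * Suc m) = d / real (Suc m)" for m
    by (simp only: of_nat_mult) (simp del: of_nat_Suc)
  show ?thesis
    using LIMSEQ_subseq_LIMSEQ[OF lim mono] unfolding o_def * ou_sum_def
    by simp
qed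

text \<open>The first M cells cover the stretch from t + d down to t. The others form the sum that
  starts at t, and the exponential kernel being multiplicative, they are damped by a common factor:
  a discrete form of the Ornstein-Uhlenbeck flow.\<close>

lemma ou_sum_shift:
  assumes "real M * \<delta> = d"
  shows "ou_sum \<alpha> g (t + d) \<delta> (M + N) = ou_sum \<alpha> g (t + d) \<delta> M + exp (- \<alpha> * d) * ou_sum \<alpha> g t \<delta> N"
proof -
  have shift: "t + d - real (M + i) * \<delta> = t - real i * \<delta>" for i
    using assms by (simp add: algebra_simps)
  have shift': "t + d - real (Suc (M + i)) * \<delta> = t - real (Suc i) * \<delta>" for i
    using shift[of "Suc i"] by simp
  have ex: "exp (- \<alpha> * (real (M + i) * \<delta>)) = exp (- \<alpha> * d) * exp (- \<alpha> * (real i * \<delta>))" for i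
    using assms by (simp add: exp_add[symmetric] algebra_simps)
  let ?F = "\<lambda>i. exp (- \<alpha> * (real i * \<delta>)) * (g (t + d - real i * \<delta>) - g (t + d - real (Suc i) * \<delta>))"
  have "(\<Sum>i<M + N. ?F i) = (\<Sum>i<M. ?F i) + (\<Sum>i<N. ?F (M + i))"
    by (induction N) auto
  then show ?thesis
    unfolding ou_sum_def shift shift' ex by (simp add: sum_distrib_left mult.assoc)
qed

text \<open>The lower limits \<open>t - (j + 1) d\<close> and the steps \<open>d / (m + 1)\<close> make \<open>t\<close> a grid point of the sums
  for the integral up to \<open>t + d\<close>, so that no additivity of the Riemann-Stieltjes integral is needed.\<close>

lemma ou_increment_limit:
  assumes I: "has_improper_rs_integral (\<lambda>u. exp (- \<alpha> * (t - u))) g t I"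
    and I': "has_improper_rs_integral (\<lambda>u. exp (- \<alpha> * (t + d - u))) g (t + d) I'"
    and d: "d > 0"
  shows "\<exists>J. (\<forall>j. (\<lambda>m. ou_sum \<alpha> g (t + d) (d / real (Suc m)) (Suc m) - (g (t + d) - g t)
      - (1 - exp (- \<alpha> * d)) * ou_sum \<alpha> g t (d / real (Suc m)) (Suc j * Suc m)) \<longlonglongrightarrow> J j)
    \<and> J \<longlonglongrightarrow> I' - I - (g (t + d) - g t)"
proof -
  obtain L L' where L: "\<And>a. a \<le> t \<Longrightarrow> has_rs_integral (\<lambda>u. exp (- \<alpha> * (t - u))) g a t (L a)" "(L \<longlongrightarrow> I) at_bot"
    and L': "\<And>a. a \<le> t + d \<Longrightarrow> has_rs_integral (\<lambda>u. exp (- \<alpha> * (t + d - u))) g a (t + d) (L' a)" "(L' \<longlongrightarrow> I') at_bot"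
    using I I' unfolding has_improper_rs_integral_def by auto
  define J where "J j = L' (t - real (Suc j) * d) - L (t - real (Suc j) * d) - (g (t + d) - g t)" for j
  have "filterlim (\<lambda>j. real (Suc j) * d) at_top sequentially"
    by (rule filterlim_at_top_mult_tendsto_pos[OF tendsto_const d])
      (rule filterlim_compose[OF filterlim_real_sequentially filterlim_Suc])
  then have bot: "filterlim (\<lambda>j. t - real (Suc j) * d) at_bot sequentially"
    using filterlim_tendsto_add_at_top[OF tendsto_const[of "-t"]]
    by (subst filterlim_uminus_at_bot) simp
  have lim: "J \<longlonglongrightarrow> I' - I - (g (t + d) - g t)"
    unfolding J_def by (intro tendsto_intros filterlim_compose[OF L(2) bot] filterlim_compose[OF L'(2) bot])
  have "(\<lambda>m. ou_sum \<alpha> g (t + d) (d / real (Suc m)) (Suc m) - (g (t + d) - g t)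
      - (1 - exp (- \<alpha> * d)) * ou_sum \<alpha> g t (d / real (Suc m)) (Suc j * Suc m)) \<longlonglongrightarrow> J j" for j
  proof -
    let ?a = "t - real (Suc j) * d"
    have a_le: "?a \<le> t" using d by simp
    \<comment> \<open>Starting from t + d, one more block of length d is needed to reach the same
      lower limit.\<close>
    have *: "t + d - real (Suc (Suc j)) * d = ?a" by (simp add: algebra_simps)
    have "(\<lambda>m. ou_sum \<alpha> g (t + d) (d / real (Suc m)) (Suc (Suc j) * Suc m)) \<longlonglongrightarrow> L' ?a"
      by (rule ou_sum_limit[OF _ d], unfold *, rule L'(1)) (use a_le d in linarith)
    moreover have "(\<lambda>m. ou_sum \<alpha> g t (d / real (Suc m)) (Suc j * Suc m)) \<longlonglongrightarrow> L ?a"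
      by (rule ou_sum_limit[OF _ d], rule L(1), rule a_le)
    ultimately have "(\<lambda>m. ou_sum \<alpha> g (t + d) (d / real (Suc m)) (Suc (Suc j) * Suc m)
        - ou_sum \<alpha> g t (d / real (Suc m)) (Suc j * Suc m) - (g (t + d) - g t)) \<longlonglongrightarrow> J j"
      unfolding J_def by (intro tendsto_intros)
    moreover have "ou_sum \<alpha> g (t + d) (d / real (Suc m)) (Suc (Suc j) * Suc m) =
        ou_sum \<alpha> g (t + d) (d / real (Suc m)) (Suc m) +
        exp (- \<alpha> * d) * ou_sum \<alpha> g t (d / real (Suc m)) (Suc j * Suc m)" for m
      unfolding mult_Suc[of "Suc j"] by (rule ou_sum_shift) (simp del: of_nat_Suc)
    ultimately show ?thesis by (simp add: algebra_simps)
  qed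
  with lim show ?thesis by blast
qed

section \<open>Fourth powers of sums with monotone weights\<close>

lemma weighted_sum_power4:
  fixes w x :: "'i \<Rightarrow> real"
  assumes "finite S" "\<And>i. i \<in> S \<Longrightarrow> w i \<ge> 0"
  shows "(\<Sum>i\<in>S. w i * x i) ^ 4 \<le> (\<Sum>i\<in>S. w i) ^ 3 * (\<Sum>i\<in>S. w i * x i ^ 4)"
proof (cases "sum w S = 0")
  case True
  then have "\<forall>i\<in>S. w i = 0" using assms sum_nonneg_eq_0_iff by blast
  then show ?thesis by simp
next
  case False
  define W where "W = sum w S"
  have W: "W > 0" using False assms sum_nonneg[of S w] unfolding W_def by fastforce
  \<comment> \<open>Jensen's inequality for the probability weights \<open>w i / W\<close>. Undoing
    the normalization costs W^4 on the left and W on the right, hence the factor W^3.\<close>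
  have "(\<Sum>i\<in>S. (w i / W) *\<^sub>R x i) ^ 4 \<le> (\<Sum>i\<in>S. (w i / W) * x i ^ 4)"
  proof (rule convex_on_sum[where f="\<lambda>x. x ^ 4" and C=UNIV])
    show "S \<noteq> {}" using False by auto
    show "convex_on UNIV (\<lambda>x::real. x ^ 4)" by (rule convex_power_even) simp
    show "(\<Sum>i\<in>S. w i / W) = 1" using W by (simp add: sum_divide_distrib[symmetric] W_def)
  qed (use assms W in auto)
  then have "((\<Sum>i\<in>S. w i * x i) / W) ^ 4 \<le> (\<Sum>i\<in>S. w i * x i ^ 4) / W"
    by (simp add: sum_divide_distrib)
  then have "(\<Sum>i\<in>S. w i * x i) ^ 4 \<le> W ^ 4 * ((\<Sum>i\<in>S. w i * x i ^ 4) / W)"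
    using W by (simp add: power_divide divide_le_eq mult.commute)
  also have "\<dots> = W ^ 3 * (\<Sum>i\<in>S. w i * x i ^ 4)"
    using W by (simp add: eval_nat_numeral)
  finally show ?thesis by (simp add: W_def)
qed

text \<open>In the applications \<open>D i\<close> is the increment of the path from a base point to
  the i-th grid point, so \<open>D 0 = 0\<close> and only the boundary term at N remains.\<close>

lemma abel_summation:
  fixes f D :: "nat \<Rightarrow> real"
  assumes "D 0 = 0"
  shows "(\<Sum>i<N. f i * (D i - D (Suc i))) = - (f N * D N + (\<Sum>i<N. (f i - f (Suc i)) * D (Suc i)))"
  using assms by (induction N) (auto simp: algebra_simps)

text \<open>After summation by parts the weights \<open>f i - f (Suc i)\<close> are nonnegative and
  telescope. Together with the boundary weight their total is
  \<open>\<bar>f N\<bar> + (f 0 - f N)\<close>, whatever the number of cells.\<close>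

lemma antimono_sum_power4:
  fixes f D :: "nat \<Rightarrow> real"
  assumes D: "D 0 = 0" and f: "\<And>i. i < N \<Longrightarrow> f (Suc i) \<le> f i"
  shows "(\<Sum>i<N. f i * (D i - D (Suc i))) ^ 4 \<le>
    (\<bar>f N\<bar> + (f 0 - f N)) ^ 3 * (\<bar>f N\<bar> * D N ^ 4 + (\<Sum>i<N. (f i - f (Suc i)) * D (Suc i) ^ 4))"
proof -
  \<comment> \<open>Index N carries the boundary term; its sign is moved into \<open>x\<close>, so
    that all weights are nonnegative.\<close>
  define w where "w i = (if i = N then \<bar>f N\<bar> else f i - f (Suc i))" for i
  define x where "x i = (if i = N then sgn (f N) * D N else D (Suc i))" for i
  have tel: "(\<Sum>i<N. f i - f (Suc i)) = f 0 - f N" by (induction N) auto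
  have eq: "(\<Sum>i<N. f i * (D i - D (Suc i))) = - (\<Sum>i<Suc N. w i * x i)"
    unfolding abel_summation[where D=D, OF D] by (simp add: w_def x_def mult.assoc[symmetric] abs_mult_sgn)
  have "(\<Sum>i<N. f i * (D i - D (Suc i))) ^ 4 = (\<Sum>i<Suc N. w i * x i) ^ 4"
    unfolding eq by (rule power_minus_even) simp
  also have "\<dots> \<le> (\<Sum>i<Suc N. w i) ^ 3 * (\<Sum>i<Suc N. w i * x i ^ 4)"
    by (rule weighted_sum_power4) (use f in \<open>auto simp: w_def\<close>)
  also have "(\<Sum>i<Suc N. w i) = \<bar>f N\<bar> + (f 0 - f N)" by (simp add: w_def tel)
  also have "(\<Sum>i<Suc N. w i * x i ^ 4) = \<bar>f N\<bar> * D N ^ 4 + (\<Sum>i<N. (f i - f (Suc i)) * D (Suc i) ^ 4)"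
    by (simp add: w_def x_def power_mult_distrib sgn_if)
  finally show ?thesis .
qed

section \<open>Fourth moments of the remainders\<close>

text \<open>Convexity of the fourth power at the midpoint of x and -y; the constant is 2^4 /
  2.\<close>

lemma power4_diff_le: "(x - y) ^ 4 \<le> 8 * (x ^ 4 + y ^ 4)" for x y :: real
proof -
  have "convex_on UNIV (\<lambda>x::real. x ^ 4)" by (rule convex_power_even) simp
  from convex_onD[OF this, of "1/2" x "-y"] show ?thesis
    by (simp add: power_divide add_divide_distrib[symmetric] diff_divide_distrib[symmetric])
qed

context prob_space
begin

lemma antimono_sum_fourth_moment:
  fixes f c :: "nat \<Rightarrow> real" and D :: "nat \<Rightarrow> 'a \<Rightarrow> real"
  assumes D0: "\<And>\<omega>. D 0 \<omega> = 0" and f: "\<And>i. i < N \<Longrightarrow> f (Suc i) \<le> f i"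
    and int: "\<And>i. integrable M (\<lambda>\<omega>. D i \<omega> ^ 4)" and c: "\<And>i. i \<le> N \<Longrightarrow> expectation (\<lambda>\<omega>. D i \<omega> ^ 4) \<le> c i"
  obtains U where "integrable M U" "\<And>\<omega>. (\<Sum>i<N. f i * (D i \<omega> - D (Suc i) \<omega>)) ^ 4 \<le> U \<omega>"
    "expectation U \<le> (\<bar>f N\<bar> + (f 0 - f N)) ^ 3 * (\<bar>f N\<bar> * c N + (\<Sum>i<N. (f i - f (Suc i)) * c (Suc i)))"
proof
  define U where "U \<omega> = (\<bar>f N\<bar> + (f 0 - f N)) ^ 3 * (\<bar>f N\<bar> * D N \<omega> ^ 4 + (\<Sum>i<N. (f i - f (Suc i)) * D (Suc i) \<omega> ^ 4))" for \<omega>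
  show "integrable M U" unfolding U_def using int by simp
  show "(\<Sum>i<N. f i * (D i \<omega> - D (Suc i) \<omega>)) ^ 4 \<le> U \<omega>" for \<omega>
    unfolding U_def using f by (rule antimono_sum_power4[where D="\<lambda>i. D i \<omega>", OF D0])
  have "f N \<le> f 0" using f by (induction N) (auto intro: order_trans)
  moreover have "expectation (\<lambda>\<omega>. \<bar>f N\<bar> * D N \<omega> ^ 4 + (\<Sum>i<N. (f i - f (Suc i)) * D (Suc i) \<omega> ^ 4)) =
      \<bar>f N\<bar> * expectation (\<lambda>\<omega>. D N \<omega> ^ 4) + (\<Sum>i<N. (f i - f (Suc i)) * expectation (\<lambda>\<omega>. D (Suc i) \<omega> ^ 4))"
    using int by (subst Bochner_Integration.integral_add) (simp_all add: Bochner_Integration.integral_sum)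
  moreover have "\<dots> \<le> \<bar>f N\<bar> * c N + (\<Sum>i<N. (f i - f (Suc i)) * c (Suc i))"
    by (intro add_mono sum_mono mult_left_mono c) (use f in auto)
  ultimately show "expectation U \<le> (\<bar>f N\<bar> + (f 0 - f N)) ^ 3 * (\<bar>f N\<bar> * c N + (\<Sum>i<N. (f i - f (Suc i)) * c (Suc i)))"
    unfolding U_def integral_mult_right_zero
    by (intro mult_left_mono) auto
qed

text \<open>The contribution of the past. The bound involves neither t nor N, so it survives the
  passage of the lower limit to minus infinity. It works because the moments are allowed to grow at
  only half the rate at which the kernel decays.\<close>

lemma ou_sum_fourth_moment:
  assumes \<alpha>: "\<alpha> > 0" and \<delta>: "\<delta> > 0" and C: "C \<ge> 0"
    and int: "\<And>s t. integrable M (\<lambda>\<omega>. (G s \<omega> - G t \<omega>) ^ 4)"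
    and mom: "\<And>s t. expectation (\<lambda>\<omega>. (G s \<omega> - G t \<omega>) ^ 4) \<le> C * exp (\<alpha> * \<bar>s - t\<bar> / 2)"
  obtains U where "integrable M U" "\<And>\<omega>. ou_sum \<alpha> (\<lambda>s. G s \<omega>) t \<delta> N ^ 4 \<le> U \<omega>"
    "expectation U \<le> C * (2 + exp (\<alpha> * \<delta> / 2))"
proof -
  \<comment> \<open>The kernel at the i-th grid point is q^(2i), the moment bound there C /
    q^i.\<close>
  define q where "q = exp (- \<alpha> * \<delta> / 2)"
  define f where "f i = exp (- \<alpha> * (real i * \<delta>))" for i
  have q: "0 < q" "q \<le> 1" using \<alpha> \<delta> by (auto simp: q_def)
  have f: "f i = (q ^ i)\<^sup>2" for i
    unfolding f_def q_def by (simp add: exp_of_nat_mult[symmetric] exp_double[symmetric] algebra_simps)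
  have c_eq: "exp (\<alpha> * \<bar>t - real i * \<delta> - t\<bar> / 2) = 1 / q ^ i" for i
    unfolding q_def using \<delta> by (simp add: exp_of_nat_mult[symmetric] exp_minus field_simps)
  have le_c: "expectation (\<lambda>\<omega>. (G (t - real i * \<delta>) \<omega> - G t \<omega>) ^ 4) \<le> C * (1 / q ^ i)" for i
    using mom[of "t - real i * \<delta>" t] unfolding c_eq .
  have mono: "f (Suc i) \<le> f i" for i
    unfolding f_def using \<alpha> \<delta> by (simp add: algebra_simps)
  obtain U where U: "integrable M U"
    "\<And>\<omega>. (\<Sum>i<N. f i * ((G (t - real i * \<delta>) \<omega> - G t \<omega>) - (G (t - real (Suc i) * \<delta>) \<omega> - G t \<omega>))) ^ 4 \<le> U \<omega>"
    "expectation U \<le> (\<bar>f N\<bar> + (f 0 - f N)) ^ 3 * (\<bar>f N\<bar> * (C * (1 / q ^ N)) + (\<Sum>i<N. (f i - f (Suc i)) * (C * (1 / q ^ Suc i))))"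
    by (rule antimono_sum_fourth_moment[where D="\<lambda>i \<omega>. G (t - real i * \<delta>) \<omega> - G t \<omega>" and f=f
        and N=N and c="\<lambda>i. C * (1 / q ^ i)"]) (simp_all only: int le_c mono, simp)
  have "f N \<ge> 0" "f 0 = 1" by (auto simp: f_def)
  \<comment> \<open>Half of the exponential weight absorbs the growth of the moments; the other half telescopes.\<close>
  have step: "(f i - f (Suc i)) * (C * (1 / q ^ Suc i)) = C * (1 + 1 / q) * (q ^ i - q ^ Suc i)" for i
    unfolding f using q by (simp add: field_simps power2_eq_square)
  have tel: "(\<Sum>i<N. q ^ i - q ^ Suc i) = 1 - q ^ N" by (induction N) auto
  have "f N * (C * (1 / q ^ N)) = C * q ^ N" unfolding f using q by (simp add: power2_eq_square)
  then have "expectation U \<le> C * q ^ N + C * (1 + 1 / q) * (1 - q ^ N)"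
    using U(3) \<open>f N \<ge> 0\<close> \<open>f 0 = 1\<close> unfolding step sum_distrib_left[symmetric] tel by simp
  also have "\<dots> \<le> C * 1 + C * (1 + 1 / q) * 1"
    using q C by (intro add_mono mult_left_mono) (auto simp: power_le_one)
  also have "\<dots> = C * (2 + exp (\<alpha> * \<delta> / 2))"
    unfolding q_def by (simp add: exp_minus inverse_eq_divide[symmetric] algebra_simps)
  finally show ?thesis using that U unfolding ou_sum_def f_def by simp
qed

text \<open>The local part over \<open>[t, t + d]\<close>. Subtracting the increment of G lowers
  every weight by 1, so the weights decrease from 0 to \<open>- (1 - exp (- \<alpha> * d))\<close>,
  and this small total variation enters to the fourth power.\<close>

lemma ou_sum_increment_fourth_moment:
  assumes \<alpha>: "\<alpha> > 0" and \<delta>: "\<delta> > 0" and C: "C \<ge> 0" and d: "real N * \<delta> = d"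
    and int: "\<And>s t. integrable M (\<lambda>\<omega>. (G s \<omega> - G t \<omega>) ^ 4)"
    and mom: "\<And>s t. expectation (\<lambda>\<omega>. (G s \<omega> - G t \<omega>) ^ 4) \<le> C * exp (\<alpha> * \<bar>s - t\<bar> / 2)"
  obtains U where "integrable M U"
    "\<And>\<omega>. (ou_sum \<alpha> (\<lambda>s. G s \<omega>) (t + d) \<delta> N - (G (t + d) \<omega> - G t \<omega>)) ^ 4 \<le> U \<omega>"
    "expectation U \<le> 16 * (1 - exp (- \<alpha> * d)) ^ 4 * C * exp (\<alpha> * d / 2)"
proof -
  define f where "f i = exp (- \<alpha> * (real i * \<delta>)) - 1" for i
  define c where "c = C * exp (\<alpha> * d / 2)"
  define w where "w = 1 - exp (- \<alpha> * d)"
  have mono: "f (Suc i) \<le> f i" for i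
    unfolding f_def using \<alpha> \<delta> by (simp add: algebra_simps)
  have le_c: "expectation (\<lambda>\<omega>. (G (t + d - real i * \<delta>) \<omega> - G (t + d) \<omega>) ^ 4) \<le> c" if "i \<le> N" for i
  proof -
    have "real i * \<delta> \<le> d" using that d \<delta> by (metis mult_right_mono of_nat_le_iff less_imp_le)
    then have "C * exp (\<alpha> * \<bar>t + d - real i * \<delta> - (t + d)\<bar> / 2) \<le> c"
      unfolding c_def using C \<alpha> \<delta> by (intro mult_left_mono) auto
    with mom show ?thesis by (rule order_trans)
  qed
  obtain U where U: "integrable M U"
    "\<And>\<omega>. (\<Sum>i<N. f i * ((G (t + d - real i * \<delta>) \<omega> - G (t + d) \<omega>) - (G (t + d - real (Suc i) * \<delta>) \<omega> - G (t + d) \<omega>))) ^ 4 \<le> U \<omega>"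
    "expectation U \<le> (\<bar>f N\<bar> + (f 0 - f N)) ^ 3 * (\<bar>f N\<bar> * c + (\<Sum>i<N. (f i - f (Suc i)) * c))"
    by (rule antimono_sum_fourth_moment[where D="\<lambda>i \<omega>. G (t + d - real i * \<delta>) \<omega> - G (t + d) \<omega>" and f=f
        and N=N and c="\<lambda>i. c"]) (use int le_c mono in auto)
  have fN: "f N = - w" "f 0 = 0" using d by (auto simp: f_def w_def)
  have "0 \<le> real N * \<delta>" using \<delta> by simp
  then have w0: "w \<ge> 0" using \<alpha> d by (simp add: w_def)
  have "(\<Sum>i<n. (f i - f (Suc i)) * c) = (f 0 - f n) * c" for n
    by (induction n) (auto simp: algebra_simps)
  \<comment> \<open>The total weight is w + w, so the bound reads (2 w)^3 * (w c + w c).\<close>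
  then have EU: "expectation U \<le> 16 * w ^ 4 * c"
    using U(3) fN w0 by (simp add: power_mult_distrib eval_nat_numeral algebra_simps)
  \<comment> \<open>The subtracted unit weights telescope to the increment of g. The number n of
    cells is kept free for the induction, since N is tied to d.\<close>
  have tel: "\<forall>g n. (\<Sum>i<n. f i * ((g (t + d - real i * \<delta>) - g (t + d)) - (g (t + d - real (Suc i) * \<delta>) - g (t + d))))
      = ou_sum \<alpha> g (t + d) \<delta> n - (g (t + d) - g (t + d - real n * \<delta>))"
  proof (intro allI)
    fix g :: "real \<Rightarrow> real" and n
    show "(\<Sum>i<n. f i * ((g (t + d - real i * \<delta>) - g (t + d)) - (g (t + d - real (Suc i) * \<delta>) - g (t + d))))
      = ou_sum \<alpha> g (t + d) \<delta> n - (g (t + d) - g (t + d - real n * \<delta>))"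
      by (induction n) (auto simp: ou_sum_def f_def algebra_simps)
  qed
  have "(ou_sum \<alpha> (\<lambda>s. G s \<omega>) (t + d) \<delta> N - (G (t + d) \<omega> - G t \<omega>)) ^ 4 \<le> U \<omega>" for \<omega>
    using U(2)[of \<omega>] tel[rule_format, of "\<lambda>s. G s \<omega>" N] d by simp
  then show ?thesis using that U(1) EU by (simp add: c_def w_def mult.assoc)
qed

text \<open>Fatou's lemma twice: inside for the mesh (m), outside for the lower limit (j). The
  intermediate limit \<open>J\<close> is only chosen path by path; writing the limit as an iterated
  liminf of the sums avoids the question whether \<open>J\<close> is measurable.\<close>

lemma fourth_moment_iterated_limit:
  fixes S :: "nat \<Rightarrow> nat \<Rightarrow> 'a \<Rightarrow> real"
  assumes meas: "\<And>j m. S j m \<in> borel_measurable M" and X: "X \<in> borel_measurable M" and K: "K \<ge> 0"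
    and bound: "\<And>j m. (\<integral>\<^sup>+\<omega>. ennreal (S j m \<omega> ^ 4) \<partial>M) \<le> ennreal K"
    and lim: "AE \<omega> in M. \<exists>J. (\<forall>j. (\<lambda>m. S j m \<omega>) \<longlonglongrightarrow> J j) \<and> J \<longlonglongrightarrow> X \<omega>"
  shows "integrable M (\<lambda>\<omega>. X \<omega> ^ 4)" "expectation (\<lambda>\<omega>. X \<omega> ^ 4) \<le> K"
proof -
  note [measurable] = meas X
  have ae: "AE \<omega> in M. ennreal (X \<omega> ^ 4) = liminf (\<lambda>j. liminf (\<lambda>m. ennreal (S j m \<omega> ^ 4)))"
    using lim
  proof eventually_elim
    case (elim \<omega>)
    then obtain J where J: "\<And>j. (\<lambda>m. S j m \<omega>) \<longlonglongrightarrow> J j" "J \<longlonglongrightarrow> X \<omega>" by auto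
    have "liminf (\<lambda>m. ennreal (S j m \<omega> ^ 4)) = ennreal (J j ^ 4)" for j
      by (intro lim_imp_Liminf tendsto_ennrealI tendsto_power J) simp
    moreover have "liminf (\<lambda>j. ennreal (J j ^ 4)) = ennreal (X \<omega> ^ 4)"
      by (intro lim_imp_Liminf tendsto_ennrealI tendsto_power J) simp
    ultimately show ?case by simp
  qed
  have le_K: "liminf u \<le> ennreal K" if "\<And>i. u i \<le> ennreal K" for u :: "nat \<Rightarrow> ennreal"
    using Liminf_mono[of u "\<lambda>_. ennreal K" sequentially] that by (simp add: Liminf_const)
  have "(\<integral>\<^sup>+\<omega>. ennreal (X \<omega> ^ 4) \<partial>M) = (\<integral>\<^sup>+\<omega>. liminf (\<lambda>j. liminf (\<lambda>m. ennreal (S j m \<omega> ^ 4))) \<partial>M)"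
    by (rule nn_integral_cong_AE) (rule ae)
  also have "\<dots> \<le> liminf (\<lambda>j. \<integral>\<^sup>+\<omega>. liminf (\<lambda>m. ennreal (S j m \<omega> ^ 4)) \<partial>M)"
    by (rule nn_integral_liminf) measurable
  also have "\<dots> \<le> ennreal K"
  proof (rule le_K)
    fix j
    have "(\<integral>\<^sup>+\<omega>. liminf (\<lambda>m. ennreal (S j m \<omega> ^ 4)) \<partial>M) \<le> liminf (\<lambda>m. \<integral>\<^sup>+\<omega>. ennreal (S j m \<omega> ^ 4) \<partial>M)"
      by (rule nn_integral_liminf) measurable
    also have "\<dots> \<le> ennreal K" by (intro le_K bound)
    finally show "(\<integral>\<^sup>+\<omega>. liminf (\<lambda>m. ennreal (S j m \<omega> ^ 4)) \<partial>M) \<le> ennreal K" .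
  qed
  finally have nn: "(\<integral>\<^sup>+\<omega>. ennreal (X \<omega> ^ 4) \<partial>M) \<le> ennreal K" .
  show int: "integrable M (\<lambda>\<omega>. X \<omega> ^ 4)"
  proof (rule integrableI_nonneg)
    show "(\<integral>\<^sup>+\<omega>. ennreal (X \<omega> ^ 4) \<partial>M) < \<infinity>" using nn by (simp add: order_le_less_trans)
  qed auto
  show "expectation (\<lambda>\<omega>. X \<omega> ^ 4) \<le> K"
    using nn nn_integral_eq_integral[OF int] K by simp
qed

text \<open>The residual is the iterated limit of \<nu> times (local part minus w times past part),
  with \<open>w \<le> \<alpha> * d\<close>. The fourth moments of both terms are bounded by
  multiples of w^4. The cap \<open>d0\<close> turns the exponentials in d and in the mesh into
  constants.\<close>

lemma ou_increment_fourth_moment: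
  assumes ou: "fractional_ornstein_uhlenbeck M \<alpha> \<nu> G Y"
    and \<alpha>: "\<alpha> > 0" and C: "C \<ge> 0" and d: "0 < d" "d \<le> d0"
    and meas: "\<And>s. G s \<in> borel_measurable M"
    and int: "\<And>s t. integrable M (\<lambda>\<omega>. (G s \<omega> - G t \<omega>) ^ 4)"
    and mom: "\<And>s t. expectation (\<lambda>\<omega>. (G s \<omega> - G t \<omega>) ^ 4) \<le> C * exp (\<alpha> * \<bar>s - t\<bar> / 2)"
  shows "integrable M (\<lambda>\<omega>. (Y (t + d) \<omega> - Y t \<omega> - \<nu> * (G (t + d) \<omega> - G t \<omega>)) ^ 4)"
    and "expectation (\<lambda>\<omega>. (Y (t + d) \<omega> - Y t \<omega> - \<nu> * (G (t + d) \<omega> - G t \<omega>)) ^ 4)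
      \<le> 8 * \<nu> ^ 4 * \<alpha> ^ 4 * C * (2 + 17 * exp (\<alpha> * d0 / 2)) * d ^ 4"
proof -
  note [measurable] = meas
  have Ymeas [measurable]: "Y s \<in> borel_measurable M" for s
    using ou unfolding fractional_ornstein_uhlenbeck_def by auto
  define w where "w = 1 - exp (- \<alpha> * d)"
  have w: "0 \<le> w" "w \<le> \<alpha> * d" using \<alpha> d exp_ge_add_one_self[of "- \<alpha> * d"] by (auto simp: w_def)
  define K where "K = 8 * \<nu> ^ 4 * \<alpha> ^ 4 * C * (2 + 17 * exp (\<alpha> * d0 / 2)) * d ^ 4"
  define S where "S j m \<omega> = \<nu> * (ou_sum \<alpha> (\<lambda>s. G s \<omega>) (t + d) (d / real (Suc m)) (Suc m) - (G (t + d) \<omega> - G t \<omega>)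
      - w * ou_sum \<alpha> (\<lambda>s. G s \<omega>) t (d / real (Suc m)) (Suc j * Suc m))" for j m \<omega>
  have "S j m \<in> borel_measurable M" for j m
    unfolding S_def[abs_def] ou_sum_def by measurable
  moreover have "(\<lambda>\<omega>. Y (t + d) \<omega> - Y t \<omega> - \<nu> * (G (t + d) \<omega> - G t \<omega>)) \<in> borel_measurable M" by measurable
  moreover have "K \<ge> 0" using C \<alpha> d by (simp add: K_def)
  moreover have "(\<integral>\<^sup>+\<omega>. ennreal (S j m \<omega> ^ 4) \<partial>M) \<le> ennreal K" for j m
  proof -
    define \<delta> where "\<delta> = d / real (Suc m)"
    have \<delta>: "\<delta> > 0" "\<delta> \<le> d0" "real (Suc m) * \<delta> = d"
      using d divide_left_mono[of 1 "real (Suc m)" d] by (auto simp: \<delta>_def simp del: of_nat_Suc)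
    obtain U where U: "integrable M U"
      "\<And>\<omega>. (ou_sum \<alpha> (\<lambda>s. G s \<omega>) (t + d) \<delta> (Suc m) - (G (t + d) \<omega> - G t \<omega>)) ^ 4 \<le> U \<omega>"
      "expectation U \<le> 16 * w ^ 4 * C * exp (\<alpha> * d / 2)"
      by (rule ou_sum_increment_fourth_moment[where t=t, OF \<alpha> \<delta>(1) C \<delta>(3) int mom, folded w_def]) (rule that)
    obtain V where V: "integrable M V"
      "\<And>\<omega>. ou_sum \<alpha> (\<lambda>s. G s \<omega>) t \<delta> (Suc j * Suc m) ^ 4 \<le> V \<omega>"
      "expectation V \<le> C * (2 + exp (\<alpha> * \<delta> / 2))"
      by (rule ou_sum_fourth_moment[where t=t and N="Suc j * Suc m", OF \<alpha> \<delta>(1) C int mom]) (rule that)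
    define W where "W \<omega> = \<nu> ^ 4 * (8 * (U \<omega> + w ^ 4 * V \<omega>))" for \<omega>
    have W: "S j m \<omega> ^ 4 \<le> W \<omega>" for \<omega>
    proof -
      let ?Q = "ou_sum \<alpha> (\<lambda>s. G s \<omega>) (t + d) \<delta> (Suc m) - (G (t + d) \<omega> - G t \<omega>)"
      let ?P = "ou_sum \<alpha> (\<lambda>s. G s \<omega>) t \<delta> (Suc j * Suc m)"
      have "S j m \<omega> ^ 4 = \<nu> ^ 4 * (?Q - w * ?P) ^ 4"
        by (simp only: S_def \<delta>_def power_mult_distrib)
      also have "\<dots> \<le> \<nu> ^ 4 * (8 * (?Q ^ 4 + (w * ?P) ^ 4))"
        by (intro mult_left_mono power4_diff_le) auto
      also have "\<dots> \<le> W \<omega>" unfolding W_def power_mult_distrib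
        by (intro mult_left_mono add_mono U V) auto
      finally show ?thesis .
    qed
    have intW: "integrable M W" unfolding W_def using U V by simp
    have "expectation W = \<nu> ^ 4 * (8 * (expectation U + w ^ 4 * expectation V))"
      unfolding W_def using U V by simp
    also have "\<dots> \<le> \<nu> ^ 4 * (8 * (16 * w ^ 4 * C * exp (\<alpha> * d0 / 2) + w ^ 4 * (C * (2 + exp (\<alpha> * d0 / 2)))))"
    proof -
      have "16 * w ^ 4 * C * exp (\<alpha> * d / 2) \<le> 16 * w ^ 4 * C * exp (\<alpha> * d0 / 2)"
        using w C \<alpha> d by (intro mult_left_mono) auto
      moreover have "C * (2 + exp (\<alpha> * \<delta> / 2)) \<le> C * (2 + exp (\<alpha> * d0 / 2))"
        using C \<alpha> \<delta> by (intro mult_left_mono add_left_mono) auto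
      ultimately show ?thesis using U(3) V(3) w
        by (intro mult_left_mono add_mono) auto
    qed
    \<comment> \<open>17 = 16 + 1: the local part contributes 16 exponentials, the past part
      one.\<close>
    also have "\<dots> = 8 * \<nu> ^ 4 * C * (2 + 17 * exp (\<alpha> * d0 / 2)) * w ^ 4" by (simp add: algebra_simps)
    also have "\<dots> \<le> 8 * \<nu> ^ 4 * C * (2 + 17 * exp (\<alpha> * d0 / 2)) * (\<alpha> * d) ^ 4"
      using w C by (intro mult_left_mono power_mono) auto
    also have "\<dots> = K" by (simp add: K_def power_mult_distrib algebra_simps)
    finally have EW: "expectation W \<le> K" .
    have "(\<integral>\<^sup>+\<omega>. ennreal (S j m \<omega> ^ 4) \<partial>M) \<le> (\<integral>\<^sup>+\<omega>. ennreal (W \<omega>) \<partial>M)"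
      by (intro nn_integral_mono ennreal_leI W)
    also have "\<dots> = ennreal (expectation W)"
    proof (rule nn_integral_eq_integral[OF intW], rule AE_I2)
      show "0 \<le> W \<omega>" for \<omega> using order_trans[OF _ W[of \<omega>], of 0] by simp
    qed
    finally show ?thesis using EW by (simp add: order_trans ennreal_leI)
  qed
  moreover have "AE \<omega> in M. \<exists>J. (\<forall>j. (\<lambda>m. S j m \<omega>) \<longlonglongrightarrow> J j) \<and>
      J \<longlonglongrightarrow> Y (t + d) \<omega> - Y t \<omega> - \<nu> * (G (t + d) \<omega> - G t \<omega>)"
    using ou[unfolded fractional_ornstein_uhlenbeck_def, THEN conjunct2]
  proof eventually_elim
    case (elim \<omega>)
    obtain I where I: "has_improper_rs_integral (\<lambda>u. exp (- \<alpha> * (t - u))) (\<lambda>u. G u \<omega>) t I" "Y t \<omega> = \<nu> * I"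
      using elim by blast
    obtain I' where I': "has_improper_rs_integral (\<lambda>u. exp (- \<alpha> * (t + d - u))) (\<lambda>u. G u \<omega>) (t + d) I'"
      "Y (t + d) \<omega> = \<nu> * I'" using elim by blast
    from ou_increment_limit[OF I(1) I'(1) d(1)]
    obtain J where J: "\<And>j. (\<lambda>m. ou_sum \<alpha> (\<lambda>s. G s \<omega>) (t + d) (d / real (Suc m)) (Suc m) - (G (t + d) \<omega> - G t \<omega>)
      - w * ou_sum \<alpha> (\<lambda>s. G s \<omega>) t (d / real (Suc m)) (Suc j * Suc m)) \<longlonglongrightarrow> J j"
      "J \<longlonglongrightarrow> I' - I - (G (t + d) \<omega> - G t \<omega>)" unfolding w_def by blast
    have "(\<lambda>j. \<nu> * J j) \<longlonglongrightarrow> \<nu> * (I' - I - (G (t + d) \<omega> - G t \<omega>))"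
      by (intro tendsto_intros J)
    moreover have "(\<lambda>m. S j m \<omega>) \<longlonglongrightarrow> \<nu> * J j" for j
      unfolding S_def by (intro tendsto_mult tendsto_const J)
    ultimately show ?case
      unfolding I(2) I'(2) right_diff_distrib by (intro exI[of _ "\<lambda>j. \<nu> * J j"]) simp
  qed
  ultimately show "integrable M (\<lambda>\<omega>. (Y (t + d) \<omega> - Y t \<omega> - \<nu> * (G (t + d) \<omega> - G t \<omega>)) ^ 4)"
    and "expectation (\<lambda>\<omega>. (Y (t + d) \<omega> - Y t \<omega> - \<nu> * (G (t + d) \<omega> - G t \<omega>)) ^ 4)
      \<le> 8 * \<nu> ^ 4 * \<alpha> ^ 4 * C * (2 + 17 * exp (\<alpha> * d0 / 2)) * d ^ 4"
    unfolding K_def[symmetric] by (rule fourth_moment_iterated_limit)+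
qed

end

section \<open>Covariances of the increments\<close>

text \<open>For \<open>g x = \<bar>x\<bar> powr (2 * H)\<close>, half of this is the autocovariance
  at lag x of fractional Gaussian noise with Hurst index H.\<close>

definition second_diff :: "(real \<Rightarrow> real) \<Rightarrow> real \<Rightarrow> real" where
  "second_diff g x = g (x + 1) + g (x - 1) - 2 * g x"

text \<open>The second difference is of order p (p - 1) m^(p - 2). The cases fix the sign of p - 1,
  on which the asymptotic expansion depends.\<close>

lemma second_diff_powr_tendsto_0:
  assumes p: "0 < p" "p < 2"
  shows "(\<lambda>m. second_diff (\<lambda>x. \<bar>x\<bar> powr p) (real m)) \<longlonglongrightarrow> 0"
proof -
  consider "p < 1" | "p = 1" | "p > 1" by linarith
  then have "(\<lambda>m. (real m + 1) powr p + (real m - 1) powr p - 2 * real m powr p) \<longlonglongrightarrow> 0"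
  proof cases
    case 1 then show ?thesis using p by real_asymp
  next
    case 2 show ?thesis unfolding 2 by real_asymp
  next
    case 3 then show ?thesis using p by real_asymp
  qed
  moreover have "\<forall>\<^sub>F m in sequentially. (real m + 1) powr p + (real m - 1) powr p - 2 * real m powr p
      = second_diff (\<lambda>x. \<bar>x\<bar> powr p) (real m)"
    using eventually_ge_at_top[of 1] by eventually_elim (simp add: second_diff_def)
  ultimately show ?thesis by (rule Lim_transform_eventually)
qed

text \<open>Away from the origin the three points of the second difference lie on one side of 0, so
  the sign is constant and a constant factor times the unsigned second difference remains.\<close>

lemma second_diff_signed_powr_tendsto_0:
  assumes p: "0 < p" "p < 2"
  shows "(\<lambda>m. second_diff (\<lambda>x. (\<rho> - sign0 x * e) * \<bar>x\<bar> powr p) (real m)) \<longlonglongrightarrow> 0"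
    and "(\<lambda>m. second_diff (\<lambda>x. (\<rho> - sign0 x * e) * \<bar>x\<bar> powr p) (- real m)) \<longlonglongrightarrow> 0"
proof -
  let ?s = "\<lambda>m. second_diff (\<lambda>x. \<bar>x\<bar> powr p) (real m)"
  have lim: "(\<lambda>m. c * ?s m) \<longlonglongrightarrow> 0" for c
    using tendsto_mult[OF tendsto_const[of c] second_diff_powr_tendsto_0[OF p]] by simp
  have "\<forall>\<^sub>F m in sequentially. (\<rho> - e) * ?s m = second_diff (\<lambda>x. (\<rho> - sign0 x * e) * \<bar>x\<bar> powr p) (real m)"
    using eventually_ge_at_top[of 2]
    by eventually_elim (simp add: second_diff_def sign0_def algebra_simps)
  with lim show "(\<lambda>m. second_diff (\<lambda>x. (\<rho> - sign0 x * e) * \<bar>x\<bar> powr p) (real m)) \<longlonglongrightarrow> 0"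
    by (rule Lim_transform_eventually)
  have "\<forall>\<^sub>F m in sequentially. (\<rho> + e) * ?s m = second_diff (\<lambda>x. (\<rho> - sign0 x * e) * \<bar>x\<bar> powr p) (- real m)"
    \<comment> \<open>For m = 1 the point -m + 1 would be 0, where \<open>sign0\<close> is
      1.\<close>
    using eventually_ge_at_top[of 2]
  proof eventually_elim
    case (elim m)
    then have "\<bar>- real m + 1\<bar> = real m - 1" "\<bar>- real m - 1\<bar> = real m + 1" "\<bar>real m - 1\<bar> = real m - 1"
      "sign0 (- real m + 1) = - 1" "sign0 (- real m - 1) = - 1" "sign0 (- real m) = - 1"
      by (auto simp: sign0_def)
    then show ?case by (simp add: second_diff_def algebra_simps)
  qed
  with lim show "(\<lambda>m. second_diff (\<lambda>x. (\<rho> - sign0 x * e) * \<bar>x\<bar> powr p) (- real m)) \<longlonglongrightarrow> 0"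
    by (rule Lim_transform_eventually)
qed

lemma cesaro_mean_tendsto_0:
  fixes c :: "nat \<Rightarrow> real"
  assumes "c \<longlonglongrightarrow> 0" and nn: "\<And>m. c m \<ge> 0"
  shows "(\<lambda>n. (\<Sum>m<n. c m) / real n) \<longlonglongrightarrow> 0"
proof (rule LIMSEQ_I)
  fix \<epsilon> :: real assume e: "\<epsilon> > 0"
  then obtain N where N: "\<And>m. m \<ge> N \<Longrightarrow> c m < \<epsilon> / 2"
    using LIMSEQ_D[OF assms(1), of "\<epsilon> / 2"] nn by auto
  define S where "S = (\<Sum>m<N. c m)"
  have "S \<ge> 0" unfolding S_def by (intro sum_nonneg nn)
  obtain n0 :: nat where n0: "2 * S / \<epsilon> < real n0" using reals_Archimedean2 by blast
  show "\<exists>no. \<forall>n\<ge>no. norm ((\<Sum>m<n. c m) / real n - 0) < \<epsilon>"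
  proof (intro exI allI impI)
    fix n assume n: "Suc (max n0 N) \<le> n"
    have "(\<Sum>m<n. c m) = S + (\<Sum>m=N..<n. c m)"
      unfolding S_def using n by (simp add: sum.atLeastLessThan_concat lessThan_atLeast0)
    also have "(\<Sum>m=N..<n. c m) \<le> (\<Sum>m=N..<n. \<epsilon> / 2)"
      by (rule sum_mono, rule less_imp_le, rule N) simp
    also have "\<dots> \<le> real n * (\<epsilon> / 2)" using e by simp
    also have "S < real n * (\<epsilon> / 2)"
    proof -
      have "2 * S / \<epsilon> < real n" using n0 n by linarith
      then show ?thesis using e by (simp add: field_simps)
    qed
    finally have "(\<Sum>m<n. c m) < \<epsilon> * real n" by (simp add: mult.commute)
    then show "norm ((\<Sum>m<n. c m) / real n - 0) < \<epsilon>"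
      using n nn by (simp add: divide_less_eq sum_nonneg)
  qed
qed

text \<open>Each row contains a given lag at most once on either side of the diagonal.\<close>

lemma toeplitz_sum_le:
  fixes c :: "nat \<Rightarrow> real"
  assumes nn: "\<And>m. c m \<ge> 0"
  shows "(\<Sum>k<n. \<Sum>l<n. c (if l \<le> k then k - l else l - k)) \<le> real n * (2 * (\<Sum>m<n. c m))"
proof -
  have "(\<Sum>l<n. c (if l \<le> k then k - l else l - k)) \<le> 2 * (\<Sum>m<n. c m)" if k: "k < n" for k
  proof -
    have split: "{..<n} = {..k} \<union> {k<..<n}" using k by auto
    have "(\<Sum>l<n. c (if l \<le> k then k - l else l - k)) =
        (\<Sum>l\<in>{..k}. c (if l \<le> k then k - l else l - k)) + (\<Sum>l\<in>{k<..<n}. c (if l \<le> k then k - l else l - k))"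
      unfolding split by (rule sum.union_disjoint) auto
    also have "(\<Sum>l\<in>{..k}. c (if l \<le> k then k - l else l - k)) = (\<Sum>m\<in>(\<lambda>l. k - l) ` {..k}. c m)"
      by (subst sum.reindex) (auto intro!: inj_onI)
    also have "\<dots> \<le> (\<Sum>m<n. c m)" using k by (intro sum_mono2 nn) auto
    also have "(\<Sum>l\<in>{k<..<n}. c (if l \<le> k then k - l else l - k)) = (\<Sum>m\<in>(\<lambda>l. l - k) ` {k<..<n}. c m)"
      by (subst sum.reindex) (auto intro!: inj_onI)
    also have "\<dots> \<le> (\<Sum>m<n. c m)" using k by (intro sum_mono2 nn) auto
    finally show ?thesis by simp
  qed
  then have "(\<Sum>k<n. \<Sum>l<n. c (if l \<le> k then k - l else l - k)) \<le> (\<Sum>k<n. 2 * (\<Sum>m<n. c m))"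
    by (intro sum_mono) auto
  then show ?thesis by simp
qed

context prob_space
begin

lemma process_span_integrable_mult:
  assumes X: "centered_gaussian_process M T X" and Z: "Z \<in> process_span T X" and W: "W \<in> process_span T X"
  shows "integrable M (\<lambda>\<omega>. Z \<omega> * W \<omega>)"
proof -
  have sq: "integrable M (\<lambda>\<omega>. (V \<omega>)\<^sup>2)" if "V \<in> process_span T X" for V
    using gaussian_rv_integrable_power process_span_centered_gaussian[OF X that]
    unfolding centered_gaussian_rv_def by auto
  have "(\<lambda>\<omega>. Z \<omega> * W \<omega>) = (\<lambda>\<omega>. ((Z \<omega> + W \<omega>)\<^sup>2 - (Z \<omega>)\<^sup>2 - (W \<omega>)\<^sup>2) / 2)"
    by (rule ext) (simp add: power2_eq_square algebra_simps)
  then show ?thesis using sq[OF Z] sq[OF W] sq[OF process_span_add[OF Z W]] by simp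
qed

text \<open>The terms \<open>p s\<close> and \<open>q t\<close> depend on one time only and cancel
  in a product of two increments; what is left of \<open>g\<close> on the grid is a second
  difference. Homogeneity of \<open>g\<close> extracts the step, which is self-similarity. The form
  covers a single component as well as the cross covariance.\<close>

lemma increment_covariance:
  fixes X Z :: "real \<Rightarrow> 'a \<Rightarrow> real"
  assumes int: "\<And>s t. integrable M (\<lambda>\<omega>. X s \<omega> * Z t \<omega>)"
    and cov: "\<And>s t. expectation (\<lambda>\<omega>. X s \<omega> * Z t \<omega>) = (p s + q t - g (t - s)) / 2"
    and hom: "\<And>x. g (x * d) = r * g x"
  shows "expectation (\<lambda>\<omega>. (X (real (k + 1) * d) \<omega> - X (real k * d) \<omega>) *
      (Z (real (l + 1) * d) \<omega> - Z (real l * d) \<omega>)) = r / 2 * second_diff g (real l - real k)"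
proof -
  have "expectation (\<lambda>\<omega>. (X s' \<omega> - X s \<omega>) * (Z t' \<omega> - Z t \<omega>)) =
      (g (t - s') + g (t' - s) - g (t' - s') - g (t - s)) / 2" for s s' t t'
  proof -
    have "(X s' \<omega> - X s \<omega>) * (Z t' \<omega> - Z t \<omega>) =
        X s' \<omega> * Z t' \<omega> - X s' \<omega> * Z t \<omega> - X s \<omega> * Z t' \<omega> + X s \<omega> * Z t \<omega>" for \<omega>
      by (simp add: algebra_simps)
    then have "expectation (\<lambda>\<omega>. (X s' \<omega> - X s \<omega>) * (Z t' \<omega> - Z t \<omega>)) =
        expectation (\<lambda>\<omega>. X s' \<omega> * Z t' \<omega>) - expectation (\<lambda>\<omega>. X s' \<omega> * Z t \<omega>)
        - expectation (\<lambda>\<omega>. X s \<omega> * Z t' \<omega>) + expectation (\<lambda>\<omega>. X s \<omega> * Z t \<omega>)"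
      using int by simp
    then show ?thesis unfolding cov by argo
  qed
  note cov4 = this
  have scale: "g (real a * d - real b * d) = r * g (real a - real b)" for a b
    by (simp add: hom[symmetric] left_diff_distrib)
  show ?thesis
    unfolding cov4 scale second_diff_def by (simp add: diff_divide_distrib add_divide_distrib algebra_simps)
qed

end

section \<open>Increments of bivariate fractional Brownian motion\<close>

locale bivariate_fbm_space = prob_space M
  for M :: "'w measure" +
  fixes h :: "nat \<Rightarrow> real" and \<rho> :: real and \<eta> :: "nat \<Rightarrow> nat \<Rightarrow> real" and B :: "nat \<Rightarrow> real \<Rightarrow> 'w \<Rightarrow> real"
  assumes bfbm: "bivariate_fbm M h \<rho> \<eta> B"
    and hurst: "\<And>i. i \<in> {1, 2} \<Longrightarrow> 0 < h i \<and> h i < 1"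
begin

abbreviation fbm_span :: "('w \<Rightarrow> real) set" where
  "fbm_span \<equiv> process_span ({1, 2} \<times> UNIV) (\<lambda>(i, t). B i t)"

lemma centered_gaussian: "centered_gaussian_process M ({1, 2} \<times> UNIV) (\<lambda>(i, t). B i t)"
  using bfbm by (simp add: bivariate_fbm_def)

lemma B_in_span: "i \<in> {1, 2} \<Longrightarrow> B i t \<in> fbm_span"
  using process_span_base[of "(i, t)" "{1, 2} \<times> UNIV" "\<lambda>(i, t). B i t"] by simp

lemma B_measurable: "i \<in> {1, 2} \<Longrightarrow> B i t \<in> borel_measurable M"
  using process_span_centered_gaussian[OF centered_gaussian B_in_span]
  by (auto simp: centered_gaussian_rv_def gaussian_rv_def)

lemma B_integrable_mult: "i \<in> {1, 2} \<Longrightarrow> j \<in> {1, 2} \<Longrightarrow> integrable M (\<lambda>\<omega>. B i s \<omega> * B j t \<omega>)"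
  by (intro process_span_integrable_mult[OF centered_gaussian] B_in_span)

lemma covariance_same:
  assumes "i \<in> {1, 2}"
  shows "expectation (\<lambda>\<omega>. B i s \<omega> * B i t \<omega>) =
    (\<bar>s\<bar> powr (2 * h i) + \<bar>t\<bar> powr (2 * h i) - \<bar>t - s\<bar> powr (2 * h i)) / 2"
  using bfbm assms unfolding bivariate_fbm_def fractional_brownian_motion_def
  by (auto simp: abs_minus_commute)

lemma covariance_cross:
  "expectation (\<lambda>\<omega>. B 1 s \<omega> * B 2 t \<omega>) =
    ((\<rho> + sign0 s * \<eta> 1 2) * \<bar>s\<bar> powr (h 1 + h 2) + (\<rho> - sign0 t * \<eta> 1 2) * \<bar>t\<bar> powr (h 1 + h 2)
     - (\<rho> - sign0 (t - s) * \<eta> 1 2) * \<bar>t - s\<bar> powr (h 1 + h 2)) / 2"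
  using bfbm unfolding bivariate_fbm_def by auto

lemma increment_fourth_moment:
  assumes i: "i \<in> {1, 2}"
  shows "integrable M (\<lambda>\<omega>. (B i s \<omega> - B i t \<omega>) ^ 4)"
    and "expectation (\<lambda>\<omega>. (B i s \<omega> - B i t \<omega>) ^ 4) = 3 * \<bar>s - t\<bar> powr (4 * h i)"
proof -
  have g: "centered_gaussian_rv M (\<lambda>\<omega>. B i s \<omega> - B i t \<omega>)"
    by (intro process_span_centered_gaussian[OF centered_gaussian] process_span_diff B_in_span i)
  then show "integrable M (\<lambda>\<omega>. (B i s \<omega> - B i t \<omega>) ^ 4)"
    using gaussian_rv_integrable_power[of "\<lambda>\<omega>. B i s \<omega> - B i t \<omega>" 4] by (simp add: centered_gaussian_rv_def)
  have "(B i s \<omega> - B i t \<omega>)\<^sup>2 = B i s \<omega> * B i s \<omega> - 2 * (B i s \<omega> * B i t \<omega>) + B i t \<omega> * B i t \<omega>" for \<omega>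
    by (simp add: power2_eq_square algebra_simps)
  then have "expectation (\<lambda>\<omega>. (B i s \<omega> - B i t \<omega>)\<^sup>2) = expectation (\<lambda>\<omega>. B i s \<omega> * B i s \<omega>)
      - 2 * expectation (\<lambda>\<omega>. B i s \<omega> * B i t \<omega>) + expectation (\<lambda>\<omega>. B i t \<omega> * B i t \<omega>)"
    using B_integrable_mult[OF i i] by simp
  also have "\<dots> = \<bar>s - t\<bar> powr (2 * h i)"
    unfolding covariance_same[OF i] abs_minus_commute[of t s] by (simp add: field_simps)
  finally have "expectation (\<lambda>\<omega>. (B i s \<omega> - B i t \<omega>)\<^sup>2) = \<bar>s - t\<bar> powr (2 * h i)" .
  moreover have "(\<bar>s - t\<bar> powr (2 * h i))\<^sup>2 = \<bar>s - t\<bar> powr (4 * h i)"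
    by (simp add: power2_eq_square powr_add[symmetric])
  ultimately show "expectation (\<lambda>\<omega>. (B i s \<omega> - B i t \<omega>) ^ 4) = 3 * \<bar>s - t\<bar> powr (4 * h i)"
    using centered_gaussian_rv_fourth_moment[OF g] by simp
qed

text \<open>Polynomial growth is traded for exponential growth at rate \<alpha> / 2, the form in
  which a kernel decaying at rate \<alpha> can absorb it.\<close>

lemma increment_fourth_moment_le_exp:
  assumes i: "i \<in> {1, 2}" and \<alpha>: "\<alpha> > 0"
  shows "expectation (\<lambda>\<omega>. (B i s \<omega> - B i t \<omega>) ^ 4) \<le> 3 * (1 + 4096 / \<alpha> ^ 4) * exp (\<alpha> * \<bar>s - t\<bar> / 2)"
proof -
  define x where "x = \<bar>s - t\<bar>"
  have x: "x \<ge> 0" by (simp add: x_def)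
  have "x powr (4 * h i) \<le> 1 + x ^ 4"
  proof (cases "x \<le> 1")
    case True
    then have "x powr (4 * h i) \<le> 1" using x hurst[OF i] by (intro powr_le1) auto
    then show ?thesis using x by (simp add: add_increasing2)
  next
    case False
    then have "x powr (4 * h i) \<le> x powr 4" using hurst[OF i] by (intro powr_mono) auto
    then show ?thesis using False by (simp add: powr_numeral)
  qed
  also have "\<dots> \<le> (1 + 4096 / \<alpha> ^ 4) * exp (\<alpha> * x / 2)"
  proof -
    \<comment> \<open>The divisor 8 makes the fourth power of the right side equal to
      \<open>exp (\<alpha> * x / 2)\<close>; it produces the constant 4096 = 8^4.\<close>
    have "\<alpha> * x / 8 \<le> exp (\<alpha> * x / 8)"
      using exp_ge_add_one_self[of "\<alpha> * x / 8"] by linarith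
    then have "(\<alpha> * x / 8) ^ 4 \<le> exp (\<alpha> * x / 8) ^ 4"
      using x \<alpha> by (intro power_mono) auto
    also have "\<dots> = exp (\<alpha> * x / 2)"
      by (simp flip: exp_of_nat_mult)
    finally have "x ^ 4 \<le> 4096 / \<alpha> ^ 4 * exp (\<alpha> * x / 2)"
      using \<alpha> by (simp add: power_mult_distrib power_divide field_simps)
    moreover have "1 \<le> exp (\<alpha> * x / 2)" using x \<alpha> by simp
    ultimately have "1 + x ^ 4 \<le> exp (\<alpha> * x / 2) + 4096 / \<alpha> ^ 4 * exp (\<alpha> * x / 2)"
      by (intro add_mono)
    then show ?thesis by (simp only: distrib_right mult_1)
  qed
  finally have "\<bar>s - t\<bar> powr (4 * h i) \<le> (1 + 4096 / \<alpha> ^ 4) * exp (\<alpha> * \<bar>s - t\<bar> / 2)"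
    unfolding x_def .
  then show ?thesis
    unfolding increment_fourth_moment(2)[OF i] mult.assoc by (rule mult_left_mono) simp
qed

lemma increment_covariance_same:
  assumes i: "i \<in> {1, 2}" and d: "d > 0"
  shows "expectation (\<lambda>\<omega>. (B i (real (k + 1) * d) \<omega> - B i (real k * d) \<omega>) *
      (B i (real (l + 1) * d) \<omega> - B i (real l * d) \<omega>)) =
    d powr (2 * h i) / 2 * second_diff (\<lambda>x. \<bar>x\<bar> powr (2 * h i)) (real l - real k)"
  by (rule increment_covariance[where X="B i" and Z="B i" and g="\<lambda>x. \<bar>x\<bar> powr (2 * h i)"
        and p="\<lambda>s. \<bar>s\<bar> powr (2 * h i)" and q="\<lambda>s. \<bar>s\<bar> powr (2 * h i)",
        OF B_integrable_mult[OF i i] covariance_same[OF i]])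
    (use d in \<open>simp add: abs_mult powr_mult\<close>)

text \<open>The signed power is still homogeneous, since multiplication by d > 0 does not change
  \<open>sign0\<close>.\<close>

lemma increment_covariance_cross:
  assumes d: "d > 0"
  shows "expectation (\<lambda>\<omega>. (B 1 (real (k + 1) * d) \<omega> - B 1 (real k * d) \<omega>) *
      (B 2 (real (l + 1) * d) \<omega> - B 2 (real l * d) \<omega>)) =
    d powr (h 1 + h 2) / 2 *
      second_diff (\<lambda>x. (\<rho> - sign0 x * \<eta> 1 2) * \<bar>x\<bar> powr (h 1 + h 2)) (real l - real k)"
  by (rule increment_covariance[where X="B 1" and Z="B 2"
        and g="\<lambda>x. (\<rho> - sign0 x * \<eta> 1 2) * \<bar>x\<bar> powr (h 1 + h 2)"
        and p="\<lambda>s. (\<rho> + sign0 s * \<eta> 1 2) * \<bar>s\<bar> powr (h 1 + h 2)"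
        and q="\<lambda>s. (\<rho> - sign0 s * \<eta> 1 2) * \<bar>s\<bar> powr (h 1 + h 2)",
        OF B_integrable_mult covariance_cross])
    (use d in \<open>simp_all add: abs_mult powr_mult sign0_def zero_le_mult_iff\<close>)

text \<open>Without the absolute value and up to the scale
  \<open>(d powr (h 1 + h 2))\<^sup>2\<close>, this is the covariance of two products of increments
  at lag m: the two surviving Isserlis pairings, each with a factor 1/2 * 1/2. The cross pairing
  takes the signed function at m and at -m because the two components exchange roles.\<close>

definition cov_decay :: "nat \<Rightarrow> real" where
  "cov_decay m = \<bar>second_diff (\<lambda>x. \<bar>x\<bar> powr (2 * h 1)) (real m) * second_diff (\<lambda>x. \<bar>x\<bar> powr (2 * h 2)) (real m)
    + second_diff (\<lambda>x. (\<rho> - sign0 x * \<eta> 1 2) * \<bar>x\<bar> powr (h 1 + h 2)) (real m)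
      * second_diff (\<lambda>x. (\<rho> - sign0 x * \<eta> 1 2) * \<bar>x\<bar> powr (h 1 + h 2)) (- real m)\<bar> / 4"

lemma cov_decay_tendsto_0: "cov_decay \<longlonglongrightarrow> 0"
proof -
  have h: "0 < 2 * h 1" "2 * h 1 < 2" "0 < 2 * h 2" "2 * h 2 < 2" "0 < h 1 + h 2" "h 1 + h 2 < 2"
    using hurst[of 1] hurst[of 2] by auto
  have "(\<lambda>m. cov_decay m) \<longlonglongrightarrow> \<bar>0 * 0 + 0 * 0\<bar> / 4"
    unfolding cov_decay_def
    by (intro tendsto_intros second_diff_powr_tendsto_0 second_diff_signed_powr_tendsto_0 h) simp
  then show ?thesis by simp
qed

text \<open>The squared centered sum is a double sum of covariances, each bounded by a function of
  the lag alone. Since 2 H_1 + 2 H_2 = 2 H, both pairings scale with the same power of d.\<close>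

lemma variance_increment_products:
  assumes d: "d > 0"
  defines "b \<equiv> \<lambda>i k \<omega>. B i (real (k + 1) * d) \<omega> - B i (real k * d) \<omega>"
  shows "integrable M (\<lambda>\<omega>. ((\<Sum>k<n. b 1 k \<omega> * b 2 k \<omega>) - real n * (\<rho> * d powr (h 1 + h 2)))\<^sup>2)"
    and "expectation (\<lambda>\<omega>. ((\<Sum>k<n. b 1 k \<omega> * b 2 k \<omega>) - real n * (\<rho> * d powr (h 1 + h 2)))\<^sup>2)
      \<le> (d powr (h 1 + h 2))\<^sup>2 * (real n * (2 * (\<Sum>m<n. cov_decay m)))"
proof -
  define \<mu> where "\<mu> = \<rho> * d powr (h 1 + h 2)"
  define P where "P = d powr (h 1 + h 2)"
  have b_span: "b i k \<in> fbm_span" if "i \<in> {1, 2}" for i k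
    unfolding b_def by (intro process_span_diff B_in_span that)
  have g: "centered_gaussian_rv M (\<lambda>\<omega>. p * b 1 k \<omega> + q * b 2 k \<omega> + r * b 1 l \<omega> + s * b 2 l \<omega>)" for p q r s k l
    by (intro process_span_centered_gaussian[OF centered_gaussian] process_span_intros b_span) auto
  have int2: "integrable M (\<lambda>\<omega>. b 1 k \<omega> * b 2 k \<omega>)" for k
    by (intro process_span_integrable_mult[OF centered_gaussian] b_span) auto
  have int4: "integrable M (\<lambda>\<omega>. b 1 k \<omega> * b 2 k \<omega> * (b 1 l \<omega> * b 2 l \<omega>))" for k l
    using isserlis(1)[OF g] by (simp only: mult.assoc)
  \<comment> \<open>At lag 0 the second difference is (\<rho> - \<eta>) + (\<rho> + \<eta>) = 2
    \<rho>, with \<eta> standing for \<open>\<eta> 1 2\<close>; the asymmetry cancels and the mean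
    is exact for every step.\<close>
  have mean: "expectation (\<lambda>\<omega>. b 1 k \<omega> * b 2 k \<omega>) = \<mu>" for k
    unfolding b_def increment_covariance_cross[OF d]
    by (simp add: second_diff_def sign0_def \<mu>_def algebra_simps)
  define c where "c k l = cov_decay (if l \<le> k then k - l else l - k)" for k l
  have cov: "expectation (\<lambda>\<omega>. (b 1 k \<omega> * b 2 k \<omega> - \<mu>) * (b 1 l \<omega> * b 2 l \<omega> - \<mu>)) \<le> P\<^sup>2 * c k l" for k l
  proof -
    let ?\<phi>1 = "second_diff (\<lambda>x. \<bar>x\<bar> powr (2 * h 1))"
    let ?\<phi>2 = "second_diff (\<lambda>x. \<bar>x\<bar> powr (2 * h 2))"
    let ?\<phi> = "second_diff (\<lambda>x. (\<rho> - sign0 x * \<eta> 1 2) * \<bar>x\<bar> powr (h 1 + h 2))"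
    have even: "second_diff (\<lambda>x. \<bar>x\<bar> powr p) (- x) = second_diff (\<lambda>x. \<bar>x\<bar> powr p) x" for p x
    proof -
      have "\<bar>- x + 1\<bar> = \<bar>x - 1\<bar>" "\<bar>- x - 1\<bar> = \<bar>x + 1\<bar>" by auto
      then show ?thesis by (simp add: second_diff_def)
    qed
    have "(b 1 k \<omega> * b 2 k \<omega> - \<mu>) * (b 1 l \<omega> * b 2 l \<omega> - \<mu>) =
        b 1 k \<omega> * b 2 k \<omega> * (b 1 l \<omega> * b 2 l \<omega>) - \<mu> * (b 1 k \<omega> * b 2 k \<omega>) - \<mu> * (b 1 l \<omega> * b 2 l \<omega>) + \<mu> * \<mu>" for \<omega>
      by (simp add: algebra_simps)
    then have "expectation (\<lambda>\<omega>. (b 1 k \<omega> * b 2 k \<omega> - \<mu>) * (b 1 l \<omega> * b 2 l \<omega> - \<mu>)) =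
        expectation (\<lambda>\<omega>. b 1 k \<omega> * b 2 k \<omega> * b 1 l \<omega> * b 2 l \<omega>) - \<mu> * \<mu>"
      using int4 int2 by (simp add: mean prob_space mult.assoc del: One_nat_def)
    \<comment> \<open>The pairing of each product with itself equals \<open>\<mu> * \<mu>\<close>
      and cancels against the subtracted square of the mean.\<close>
    also have "\<dots> = expectation (\<lambda>\<omega>. b 1 k \<omega> * b 1 l \<omega>) * expectation (\<lambda>\<omega>. b 2 k \<omega> * b 2 l \<omega>) +
        expectation (\<lambda>\<omega>. b 1 k \<omega> * b 2 l \<omega>) * expectation (\<lambda>\<omega>. b 1 l \<omega> * b 2 k \<omega>)"
      unfolding isserlis(2)[OF g] by (simp add: mean mult.commute del: One_nat_def)
    also have "\<dots> = d powr (2 * h 1) * d powr (2 * h 2) * (?\<phi>1 (real l - real k) * ?\<phi>2 (real l - real k)) / 4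
        + P * P * (?\<phi> (real l - real k) * ?\<phi> (real k - real l)) / 4"
      unfolding b_def P_def
      by (simp only: increment_covariance_same[OF _ d] increment_covariance_cross[OF d] insertI1 insertI2) (simp add: mult_ac)
    also have "d powr (2 * h 1) * d powr (2 * h 2) = P\<^sup>2"
      by (simp add: P_def power2_eq_square powr_add[symmetric])
    also have "P * P = P\<^sup>2" by (simp add: power2_eq_square)
    also have "P\<^sup>2 * (?\<phi>1 (real l - real k) * ?\<phi>2 (real l - real k)) / 4 + P\<^sup>2 * (?\<phi> (real l - real k) * ?\<phi> (real k - real l)) / 4
       = P\<^sup>2 * ((?\<phi>1 (real l - real k) * ?\<phi>2 (real l - real k) + ?\<phi> (real l - real k) * ?\<phi> (real k - real l)) / 4)"
      by (simp add: field_simps)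
    also have "\<dots> \<le> P\<^sup>2 * c k l"
    proof (intro mult_left_mono)
      show "(?\<phi>1 (real l - real k) * ?\<phi>2 (real l - real k) + ?\<phi> (real l - real k) * ?\<phi> (real k - real l)) / 4 \<le> c k l"
      \<comment> \<open>A negative lag gives the same value: the unsigned second differences are
        even, and in the signed pair the factors at m and -m merely swap.\<close>
      proof (cases "l \<le> k")
        case True
        then obtain m where m: "k = l + m" using le_Suc_ex by blast
        then have diff: "real l - real k = - real m" "real k - real l = real m" and "c k l = cov_decay m"
          by (simp_all add: c_def)
        then show ?thesis
          unfolding diff cov_decay_def even mult.commute[of "?\<phi> (- real m)"] by simp
      next
        case False
        then obtain m where m: "l = k + m" using le_Suc_ex[of k l] by auto
        with False have diff: "real l - real k = real m" "real k - real l = - real m" and "c k l = cov_decay m"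
          by (simp_all add: c_def)
        then show ?thesis unfolding diff cov_decay_def by simp
      qed
    qed simp
    finally show ?thesis .
  qed
  have intc: "integrable M (\<lambda>\<omega>. (b 1 k \<omega> * b 2 k \<omega> - \<mu>) * (b 1 l \<omega> * b 2 l \<omega> - \<mu>))" for k l
    using int4 int2 by (simp add: left_diff_distrib right_diff_distrib)
  have eq: "((\<Sum>k<n. b 1 k \<omega> * b 2 k \<omega>) - real n * \<mu>)\<^sup>2 =
      (\<Sum>k<n. \<Sum>l<n. (b 1 k \<omega> * b 2 k \<omega> - \<mu>) * (b 1 l \<omega> * b 2 l \<omega> - \<mu>))" for \<omega>
    by (simp add: power2_eq_square sum_product[symmetric] sum_subtractf)
  show "integrable M (\<lambda>\<omega>. ((\<Sum>k<n. b 1 k \<omega> * b 2 k \<omega>) - real n * (\<rho> * d powr (h 1 + h 2)))\<^sup>2)"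
    unfolding \<mu>_def[symmetric] eq by (intro Bochner_Integration.integrable_sum intc)
  have "expectation (\<lambda>\<omega>. ((\<Sum>k<n. b 1 k \<omega> * b 2 k \<omega>) - real n * \<mu>)\<^sup>2) =
      (\<Sum>k<n. \<Sum>l<n. expectation (\<lambda>\<omega>. (b 1 k \<omega> * b 2 k \<omega> - \<mu>) * (b 1 l \<omega> * b 2 l \<omega> - \<mu>)))"
    unfolding eq by (simp only: Bochner_Integration.integral_sum Bochner_Integration.integrable_sum intc)
  also have "\<dots> \<le> (\<Sum>k<n. \<Sum>l<n. P\<^sup>2 * c k l)" by (intro sum_mono cov)
  also have "\<dots> = P\<^sup>2 * (\<Sum>k<n. \<Sum>l<n. c k l)" by (simp add: sum_distrib_left)
  also have "\<dots> \<le> P\<^sup>2 * (real n * (2 * (\<Sum>m<n. cov_decay m)))"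
    unfolding c_def by (intro mult_left_mono toeplitz_sum_le) (auto simp: cov_decay_def)
  finally show "expectation (\<lambda>\<omega>. ((\<Sum>k<n. b 1 k \<omega> * b 2 k \<omega>) - real n * (\<rho> * d powr (h 1 + h 2)))\<^sup>2)
      \<le> (d powr (h 1 + h 2))\<^sup>2 * (real n * (2 * (\<Sum>m<n. cov_decay m)))"
    by (simp add: \<mu>_def P_def)
qed

end

section \<open>Convergence of the estimator\<close>

lemma square_add_le: "(x + y)\<^sup>2 \<le> 2 * (x\<^sup>2 + y\<^sup>2)" for x y :: real
  using zero_le_power2[of "x - y"] by (simp add: power2_eq_square algebra_simps)

context prob_space
begin

section \<open>Square integrability and fourth powers\<close>

lemma square_integrable_scale:
  "square_integrable M X \<Longrightarrow> square_integrable M (\<lambda>\<omega>. c * X \<omega>)"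
  unfolding square_integrable_def by (auto simp: power_mult_distrib)

lemma square_integrable_add:
  assumes "square_integrable M X" "square_integrable M Y"
  shows "square_integrable M (\<lambda>\<omega>. X \<omega> + Y \<omega>)"
proof -
  have [measurable]: "X \<in> borel_measurable M" "Y \<in> borel_measurable M"
    and int: "integrable M (\<lambda>\<omega>. 2 * ((X \<omega>)\<^sup>2 + (Y \<omega>)\<^sup>2))"
    using assms by (auto simp: square_integrable_def)
  have "integrable M (\<lambda>\<omega>. (X \<omega> + Y \<omega>)\<^sup>2)"
  proof (rule Bochner_Integration.integrable_bound[OF int])
    show "AE \<omega> in M. norm ((X \<omega> + Y \<omega>)\<^sup>2) \<le> norm (2 * ((X \<omega>)\<^sup>2 + (Y \<omega>)\<^sup>2))"
    proof (rule AE_I2)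
      fix \<omega>
      show "norm ((X \<omega> + Y \<omega>)\<^sup>2) \<le> norm (2 * ((X \<omega>)\<^sup>2 + (Y \<omega>)\<^sup>2))"
        using square_add_le[of "X \<omega>" "Y \<omega>"] by simp
    qed
  qed measurable
  then show ?thesis by (simp add: square_integrable_def)
qed

lemma square_integrable_const: "square_integrable M (\<lambda>\<omega>. c)"
  by (simp add: square_integrable_def)

lemma square_integrable_sum:
  "(\<And>k. k \<in> K \<Longrightarrow> square_integrable M (X k)) \<Longrightarrow> square_integrable M (\<lambda>\<omega>. \<Sum>k\<in>K. X k \<omega>)"
  by (induction K rule: infinite_finite_induct) (auto intro: square_integrable_add square_integrable_const)

lemma integrable_power4_add:
  fixes X Y :: "'a \<Rightarrow> real"
  assumes [measurable]: "X \<in> borel_measurable M" "Y \<in> borel_measurable M"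
    and int: "integrable M (\<lambda>\<omega>. X \<omega> ^ 4)" "integrable M (\<lambda>\<omega>. Y \<omega> ^ 4)"
  shows "integrable M (\<lambda>\<omega>. (X \<omega> + Y \<omega>) ^ 4)"
proof -
  have "integrable M (\<lambda>\<omega>. 8 * (X \<omega> ^ 4 + Y \<omega> ^ 4))" using int by simp
  then show ?thesis
  proof (rule Bochner_Integration.integrable_bound)
    show "AE \<omega> in M. norm ((X \<omega> + Y \<omega>) ^ 4) \<le> norm (8 * (X \<omega> ^ 4 + Y \<omega> ^ 4))"
    proof (rule AE_I2)
      fix \<omega>
      show "norm ((X \<omega> + Y \<omega>) ^ 4) \<le> norm (8 * (X \<omega> ^ 4 + Y \<omega> ^ 4))"
        using power4_diff_le[of "X \<omega>" "- Y \<omega>"] by simp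
    qed
  qed measurable
qed

text \<open>Weighted AM-GM, 2 (x y)^2 <= l x^4 + y^4 / l, in place of the Cauchy-Schwarz inequality;
  the free weight l later balances factors of different order in the step size.\<close>

lemma square_integrable_mult:
  fixes X Y :: "'a \<Rightarrow> real"
  assumes [measurable]: "X \<in> borel_measurable M" "Y \<in> borel_measurable M"
    and int: "integrable M (\<lambda>\<omega>. X \<omega> ^ 4)" "integrable M (\<lambda>\<omega>. Y \<omega> ^ 4)"
  shows "square_integrable M (\<lambda>\<omega>. X \<omega> * Y \<omega>)"
    and "l > 0 \<Longrightarrow> expectation (\<lambda>\<omega>. (X \<omega> * Y \<omega>)\<^sup>2) \<le>
      (l * expectation (\<lambda>\<omega>. X \<omega> ^ 4) + expectation (\<lambda>\<omega>. Y \<omega> ^ 4) / l) / 2"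
proof -
  have amgm: "(x * y)\<^sup>2 \<le> (l * x ^ 4 + y ^ 4 / l) / 2" if "l > 0" for l x y :: real
  proof -
    have "0 \<le> (l * x\<^sup>2 - y\<^sup>2)\<^sup>2 / l" using that by simp
    also have "\<dots> = l * x ^ 4 + y ^ 4 / l - 2 * (x * y)\<^sup>2"
      using that by (simp add: field_simps power2_eq_square power4_eq_xxxx)
    finally show ?thesis by simp
  qed
  have i: "integrable M (\<lambda>\<omega>. (l * X \<omega> ^ 4 + Y \<omega> ^ 4 / l) / 2)" for l using int by simp
  have sq: "integrable M (\<lambda>\<omega>. (X \<omega> * Y \<omega>)\<^sup>2)"
  proof (rule Bochner_Integration.integrable_bound[OF i[of 1]])
    show "AE \<omega> in M. norm ((X \<omega> * Y \<omega>)\<^sup>2) \<le> norm ((1 * X \<omega> ^ 4 + Y \<omega> ^ 4 / 1) / 2)"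
    proof (rule AE_I2)
      fix \<omega>
      show "norm ((X \<omega> * Y \<omega>)\<^sup>2) \<le> norm ((1 * X \<omega> ^ 4 + Y \<omega> ^ 4 / 1) / 2)"
        using amgm[of 1 "X \<omega>" "Y \<omega>"] by simp
    qed
  qed measurable
  then show "square_integrable M (\<lambda>\<omega>. X \<omega> * Y \<omega>)" by (simp add: square_integrable_def)
  assume "l > 0"
  have "expectation (\<lambda>\<omega>. (X \<omega> * Y \<omega>)\<^sup>2) \<le> expectation (\<lambda>\<omega>. (l * X \<omega> ^ 4 + Y \<omega> ^ 4 / l) / 2)"
    by (rule integral_mono[OF sq i]) (rule amgm[OF \<open>l > 0\<close>])
  then show "expectation (\<lambda>\<omega>. (X \<omega> * Y \<omega>)\<^sup>2) \<le>
      (l * expectation (\<lambda>\<omega>. X \<omega> ^ 4) + expectation (\<lambda>\<omega>. Y \<omega> ^ 4) / l) / 2"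
    using int by simp
qed

text \<open>Markov's inequality for the squared error.\<close>

lemma converges_in_L2_imp_probability:
  assumes "converges_in_L2 M X Z"
  shows "converges_in_probability M X Z"
  unfolding converges_in_probability_def
proof (intro conjI allI impI)
  have sX: "square_integrable M (X n)" and sZ: "square_integrable M Z" for n
    using assms by (auto simp: converges_in_L2_def)
  then show [measurable]: "X n \<in> borel_measurable M" "Z \<in> borel_measurable M" for n
    by (auto simp: square_integrable_def)
  fix \<epsilon> :: real assume "\<epsilon> > 0"
  have int: "integrable M (\<lambda>\<omega>. (X n \<omega> - Z \<omega>)\<^sup>2)" for n
    using square_integrable_add[OF sX square_integrable_scale[OF sZ, of "-1"]] by (simp add: square_integrable_def)
  have "measure M {\<omega> \<in> space M. \<bar>X n \<omega> - Z \<omega>\<bar> > \<epsilon>} \<le> expectation (\<lambda>\<omega>. (X n \<omega> - Z \<omega>)\<^sup>2) / \<epsilon>\<^sup>2" for n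
  proof -
    have "{\<omega> \<in> space M. \<bar>X n \<omega> - Z \<omega>\<bar> > \<epsilon>} \<subseteq> {\<omega> \<in> space M. \<epsilon>\<^sup>2 \<le> (X n \<omega> - Z \<omega>)\<^sup>2}"
      using \<open>\<epsilon> > 0\<close> by (auto simp: abs_le_square_iff[symmetric])
    then have "measure M {\<omega> \<in> space M. \<bar>X n \<omega> - Z \<omega>\<bar> > \<epsilon>} \<le> measure M {\<omega> \<in> space M. \<epsilon>\<^sup>2 \<le> (X n \<omega> - Z \<omega>)\<^sup>2}"
      by (intro finite_measure_mono) measurable
    also have "\<dots> \<le> expectation (\<lambda>\<omega>. (X n \<omega> - Z \<omega>)\<^sup>2) / \<epsilon>\<^sup>2"
      by (rule integral_Markov_inequality_measure[OF int, of "{}"]) (use \<open>\<epsilon> > 0\<close> in auto)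
    finally show ?thesis .
  qed
  note bound = this
  have "(\<lambda>n. expectation (\<lambda>\<omega>. (X n \<omega> - Z \<omega>)\<^sup>2)) \<longlonglongrightarrow> 0"
    using assms unfolding converges_in_L2_def by blast
  then have lim: "(\<lambda>n. expectation (\<lambda>\<omega>. (X n \<omega> - Z \<omega>)\<^sup>2) / \<epsilon>\<^sup>2) \<longlonglongrightarrow> 0"
    by (rule tendsto_divide_zero)
  show "(\<lambda>n. measure M {\<omega> \<in> space M. \<bar>X n \<omega> - Z \<omega>\<bar> > \<epsilon>}) \<longlonglongrightarrow> 0"
    by (rule tendsto_sandwich[OF _ _ tendsto_const lim]; intro always_eventually allI bound measure_nonneg)
qed

end

context bivariate_fbm_space
begin

lemma residual_fourth_moment:
  assumes i: "i \<in> {1, 2}" and \<alpha>: "\<alpha> > 0"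
    and ou: "fractional_ornstein_uhlenbeck M \<alpha> \<nu> (B i) Y"
  obtains K where "K \<ge> 0"
    "\<And>t d. 0 < d \<Longrightarrow> d \<le> d0 \<Longrightarrow> integrable M (\<lambda>\<omega>. (Y (t + d) \<omega> - Y t \<omega> - \<nu> * (B i (t + d) \<omega> - B i t \<omega>)) ^ 4)"
    "\<And>t d. 0 < d \<Longrightarrow> d \<le> d0 \<Longrightarrow> expectation (\<lambda>\<omega>. (Y (t + d) \<omega> - Y t \<omega> - \<nu> * (B i (t + d) \<omega> - B i t \<omega>)) ^ 4) \<le> K * d ^ 4"
proof -
  have C: "0 \<le> 3 * (1 + 4096 / \<alpha> ^ 4)" using \<alpha> by simp
  note fm = ou_increment_fourth_moment[where G="B i", OF ou \<alpha> C _ _ B_measurable[OF i] increment_fourth_moment(1)[OF i]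
      increment_fourth_moment_le_exp[OF i \<alpha>]]
  show ?thesis
    by (rule that[of "8 * \<nu> ^ 4 * \<alpha> ^ 4 * (3 * (1 + 4096 / \<alpha> ^ 4)) * (2 + 17 * exp (\<alpha> * d0 / 2))"])
      (use C fm in \<open>auto intro!: mult_nonneg_nonneg add_nonneg_nonneg\<close>)
qed

text \<open>The mean square of the three remainder products relative to
  \<open>(d powr (h 1 + h 2))\<^sup>2\<close>. For instance b1 r2 has order d^(2 H_1 + 2), which
  leaves d^(2 - 2 H_2). The factor 3 comes from the square of a three-term sum, 1/2 from AM-GM, and
  3 + K from the Gaussian and the residual fourth moments. All exponents are positive because H_1,
  H_2 < 1.\<close>

definition error_bound :: "real \<Rightarrow> real \<Rightarrow> real \<Rightarrow> real \<Rightarrow> real \<Rightarrow> real" where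
  "error_bound v1 v2 K1 K2 d = 3 / 2 * (v1\<^sup>2 * (3 + K2) * d powr (2 - 2 * h 2)
        + v2\<^sup>2 * (3 + K1) * d powr (2 - 2 * h 1) + (K1 + K2) * d powr (4 - 2 * (h 1 + h 2)))"

lemma product_error_bound:
  fixes b1 b2 r1 r2 :: "'w \<Rightarrow> real"
  assumes d: "d > 0" and K: "K1 \<ge> 0" "K2 \<ge> 0"
    and [measurable]: "b1 \<in> borel_measurable M" "b2 \<in> borel_measurable M" "r1 \<in> borel_measurable M" "r2 \<in> borel_measurable M"
    and b: "integrable M (\<lambda>\<omega>. b1 \<omega> ^ 4)" "integrable M (\<lambda>\<omega>. b2 \<omega> ^ 4)"
      "expectation (\<lambda>\<omega>. b1 \<omega> ^ 4) \<le> 3 * d powr (4 * h 1)" "expectation (\<lambda>\<omega>. b2 \<omega> ^ 4) \<le> 3 * d powr (4 * h 2)"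
    and r: "integrable M (\<lambda>\<omega>. r1 \<omega> ^ 4)" "integrable M (\<lambda>\<omega>. r2 \<omega> ^ 4)"
      "expectation (\<lambda>\<omega>. r1 \<omega> ^ 4) \<le> K1 * d ^ 4" "expectation (\<lambda>\<omega>. r2 \<omega> ^ 4) \<le> K2 * d ^ 4"
  shows "square_integrable M (\<lambda>\<omega>. v1 * (b1 \<omega> * r2 \<omega>) + v2 * (b2 \<omega> * r1 \<omega>) + r1 \<omega> * r2 \<omega>)" (is ?sq)
    and "expectation (\<lambda>\<omega>. (v1 * (b1 \<omega> * r2 \<omega>) + v2 * (b2 \<omega> * r1 \<omega>) + r1 \<omega> * r2 \<omega>)\<^sup>2) \<le>
      (d powr (h 1 + h 2))\<^sup>2 * error_bound v1 v2 K1 K2 d" (is "?E \<le> ?bound")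
proof -
  have s: "square_integrable M (\<lambda>\<omega>. b1 \<omega> * r2 \<omega>)" "square_integrable M (\<lambda>\<omega>. b2 \<omega> * r1 \<omega>)"
    "square_integrable M (\<lambda>\<omega>. r1 \<omega> * r2 \<omega>)"
    by (auto intro!: square_integrable_mult(1) b r)
  show ?sq by (intro square_integrable_add square_integrable_scale s)
  note sq = this
  let ?P = "(d powr (h 1 + h 2))\<^sup>2"
  have P: "?P = d powr (2 * h 1 + 2 * h 2)"
    by (simp add: power2_eq_square powr_add[symmetric])
  have d4: "d ^ 4 = d powr 4" using d by (simp add: powr_numeral)
  \<comment> \<open>Here \<open>x\<close> is an increment of B with Hurst index f and
    \<open>y\<close> a remainder of the other component, whose index is g.\<close>
  have cross: "expectation (\<lambda>\<omega>. (x \<omega> * y \<omega>)\<^sup>2) \<le> ?P * ((3 + K) / 2 * d powr (2 - 2 * g))"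
    if "x \<in> borel_measurable M" "y \<in> borel_measurable M"
      and "integrable M (\<lambda>\<omega>. x \<omega> ^ 4)" "integrable M (\<lambda>\<omega>. y \<omega> ^ 4)"
      and x: "expectation (\<lambda>\<omega>. x \<omega> ^ 4) \<le> 3 * d powr (4 * f)" and y: "expectation (\<lambda>\<omega>. y \<omega> ^ 4) \<le> K * d ^ 4"
      and fg: "f + g = h 1 + h 2" for x y :: "'w \<Rightarrow> real" and f g K
  proof -
    \<comment> \<open>With this weight both terms of AM-GM have the same order in \<open>d\<close>.\<close>
    let ?l = "d powr (2 - 2 * f)"
    have l: "?l > 0" using d by simp
    have "expectation (\<lambda>\<omega>. (x \<omega> * y \<omega>)\<^sup>2) \<le>
      (?l * expectation (\<lambda>\<omega>. x \<omega> ^ 4) + expectation (\<lambda>\<omega>. y \<omega> ^ 4) / ?l) / 2"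
      by (rule square_integrable_mult(2)[OF that(1-4) l])
    also have "\<dots> \<le> (?l * (3 * d powr (4 * f)) + K * d ^ 4 / ?l) / 2"
      using l by (intro divide_right_mono add_mono mult_left_mono x y) auto
    also have "?l * (3 * d powr (4 * f)) = 3 * d powr (2 + 2 * f)"
    proof -
      have "?l * d powr (4 * f) = d powr (2 + 2 * f)"
        unfolding powr_add[symmetric] by (simp add: add.commute)
      then show ?thesis by simp
    qed
    also have "K * d ^ 4 / ?l = K * d powr (2 + 2 * f)"
    proof -
      have "d ^ 4 / ?l = d powr (2 + 2 * f)"
        unfolding d4 powr_diff[symmetric] by simp
      then show ?thesis by (metis times_divide_eq_right)
    qed
    also have "d powr (2 + 2 * f) = ?P * d powr (2 - 2 * g)"
    proof -
      have "2 + 2 * f = 2 * h 1 + 2 * h 2 + (2 - 2 * g)" using fg by linarith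
      then show ?thesis unfolding P powr_add[symmetric] by (rule arg_cong)
    qed
    also have "(3 * (?P * d powr (2 - 2 * g)) + K * (?P * d powr (2 - 2 * g))) / 2 =
        ?P * ((3 + K) / 2 * d powr (2 - 2 * g))" by argo
    finally show ?thesis .
  qed
  have e1: "expectation (\<lambda>\<omega>. (b1 \<omega> * r2 \<omega>)\<^sup>2) \<le> ?P * ((3 + K2) / 2 * d powr (2 - 2 * h 2))"
    by (rule cross[OF _ _ b(1) r(2) b(3) r(4)]) auto
  have e2: "expectation (\<lambda>\<omega>. (b2 \<omega> * r1 \<omega>)\<^sup>2) \<le> ?P * ((3 + K1) / 2 * d powr (2 - 2 * h 1))"
    by (rule cross[OF _ _ b(2) r(1) b(4) r(3)]) auto
  \<comment> \<open>Both remainders are of the same order, so weight 1 suffices.\<close>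
  have "expectation (\<lambda>\<omega>. (r1 \<omega> * r2 \<omega>)\<^sup>2) \<le> (1 * expectation (\<lambda>\<omega>. r1 \<omega> ^ 4) + expectation (\<lambda>\<omega>. r2 \<omega> ^ 4) / 1) / 2"
    by (rule square_integrable_mult(2)) (use r in auto)
  also have "\<dots> \<le> (K1 * d ^ 4 + K2 * d ^ 4) / 2" using r by simp
  also have "\<dots> = (K1 + K2) / 2 * d powr 4" unfolding d4 by argo
  also have "d powr 4 = ?P * d powr (4 - 2 * (h 1 + h 2))"
  proof -
    have "4 = 2 * h 1 + 2 * h 2 + (4 - 2 * (h 1 + h 2))" by simp
    then show ?thesis unfolding P powr_add[symmetric] by simp
  qed
  finally have e3: "expectation (\<lambda>\<omega>. (r1 \<omega> * r2 \<omega>)\<^sup>2) \<le> ?P * ((K1 + K2) / 2 * d powr (4 - 2 * (h 1 + h 2)))"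
    by (simp only: mult.left_commute)
  have three: "(x + y + z)\<^sup>2 \<le> 3 * (x\<^sup>2 + y\<^sup>2 + z\<^sup>2)" for x y z :: real
  proof -
    have "3 * (x\<^sup>2 + y\<^sup>2 + z\<^sup>2) - (x + y + z)\<^sup>2 = (x - y)\<^sup>2 + (y - z)\<^sup>2 + (x - z)\<^sup>2"
      by (simp add: power2_eq_square algebra_simps)
    then show ?thesis by (smt (verit) zero_le_power2)
  qed
  have ints: "integrable M (\<lambda>\<omega>. (b1 \<omega> * r2 \<omega>)\<^sup>2)" "integrable M (\<lambda>\<omega>. (b2 \<omega> * r1 \<omega>)\<^sup>2)" "integrable M (\<lambda>\<omega>. (r1 \<omega> * r2 \<omega>)\<^sup>2)"
    using s by (auto simp: square_integrable_def)
  have "?E \<le> expectation (\<lambda>\<omega>. 3 * (v1\<^sup>2 * (b1 \<omega> * r2 \<omega>)\<^sup>2 + v2\<^sup>2 * (b2 \<omega> * r1 \<omega>)\<^sup>2 + (r1 \<omega> * r2 \<omega>)\<^sup>2))"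
  proof (rule integral_mono)
    show "integrable M (\<lambda>\<omega>. (v1 * (b1 \<omega> * r2 \<omega>) + v2 * (b2 \<omega> * r1 \<omega>) + r1 \<omega> * r2 \<omega>)\<^sup>2)"
      using sq by (simp add: square_integrable_def)
    show "integrable M (\<lambda>\<omega>. 3 * (v1\<^sup>2 * (b1 \<omega> * r2 \<omega>)\<^sup>2 + v2\<^sup>2 * (b2 \<omega> * r1 \<omega>)\<^sup>2 + (r1 \<omega> * r2 \<omega>)\<^sup>2))"
      using ints by (intro integrable_mult_right Bochner_Integration.integrable_add)
    show "(v1 * (b1 \<omega> * r2 \<omega>) + v2 * (b2 \<omega> * r1 \<omega>) + r1 \<omega> * r2 \<omega>)\<^sup>2
      \<le> 3 * (v1\<^sup>2 * (b1 \<omega> * r2 \<omega>)\<^sup>2 + v2\<^sup>2 * (b2 \<omega> * r1 \<omega>)\<^sup>2 + (r1 \<omega> * r2 \<omega>)\<^sup>2)" for \<omega>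
      using three[of "v1 * (b1 \<omega> * r2 \<omega>)" "v2 * (b2 \<omega> * r1 \<omega>)" "r1 \<omega> * r2 \<omega>"]
      by (simp only: power_mult_distrib)
  qed
  also have "\<dots> = 3 * (v1\<^sup>2 * expectation (\<lambda>\<omega>. (b1 \<omega> * r2 \<omega>)\<^sup>2) + v2\<^sup>2 * expectation (\<lambda>\<omega>. (b2 \<omega> * r1 \<omega>)\<^sup>2)
      + expectation (\<lambda>\<omega>. (r1 \<omega> * r2 \<omega>)\<^sup>2))"
    by (simp only: ints integral_mult_right_zero Bochner_Integration.integral_add integrable_mult_right Bochner_Integration.integrable_add)
  also have "\<dots> \<le> 3 * (v1\<^sup>2 * (?P * ((3 + K2) / 2 * d powr (2 - 2 * h 2))) + v2\<^sup>2 * (?P * ((3 + K1) / 2 * d powr (2 - 2 * h 1)))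
      + ?P * ((K1 + K2) / 2 * d powr (4 - 2 * (h 1 + h 2))))"
    by (intro mult_left_mono add_mono e1 e2 e3) auto
  also have "\<dots> = ?bound"
    unfolding error_bound_def by (simp add: algebra_simps add_divide_distrib)
  finally show "?E \<le> ?bound" .
qed

lemma error_bound_tendsto_0:
  assumes "\<And>n. \<Delta> n > 0" "\<Delta> \<longlonglongrightarrow> 0"
  shows "(\<lambda>n. error_bound v1 v2 K1 K2 (\<Delta> n)) \<longlonglongrightarrow> 0"
proof -
  have lim: "(\<lambda>n. \<Delta> n powr p) \<longlonglongrightarrow> 0" if "p > 0" for p
    using tendsto_zero_powrI[OF assms(2) tendsto_const _ that] assms(1) by (simp add: less_imp_le)
  have "0 < 2 - 2 * h 2" "0 < 2 - 2 * h 1" "0 < 4 - 2 * (h 1 + h 2)"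
    using hurst[of 1] hurst[of 2] by auto
  then have "(\<lambda>n. error_bound v1 v2 K1 K2 (\<Delta> n)) \<longlonglongrightarrow> 3 / 2 * (v1\<^sup>2 * (3 + K2) * 0 + v2\<^sup>2 * (3 + K1) * 0 + (K1 + K2) * 0)"
    unfolding error_bound_def by (intro tendsto_intros lim)
  then show ?thesis by simp
qed

text \<open>The error splits into X, the centered and normalized empirical covariance of the
  increments of B, and W, the average of the remainder products. The factor 2 from squaring a sum
  meets the 2 from the two sides of the diagonal in X, hence the 4. For n = 0 the normalization is
  void.\<close>

lemma rho_estimator_L2_error:
  assumes d: "\<And>n. 0 < \<Delta> n" "\<And>n. \<Delta> n \<le> d0"
    and \<nu>: "\<nu> 1 > 0" "\<nu> 2 > 0"
    and Y: "\<And>i t. i \<in> {1, 2} \<Longrightarrow> Y i t \<in> borel_measurable M" and K: "\<And>i. i \<in> {1, 2} \<Longrightarrow> K i \<ge> 0"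
    and res: "\<And>i t d. i \<in> {1, 2} \<Longrightarrow> 0 < d \<Longrightarrow> d \<le> d0 \<Longrightarrow> 
        integrable M (\<lambda>\<omega>. (Y i (t + d) \<omega> - Y i t \<omega> - \<nu> i * (B i (t + d) \<omega> - B i t \<omega>)) ^ 4)"
      "\<And>i t d. i \<in> {1, 2} \<Longrightarrow> 0 < d \<Longrightarrow> d \<le> d0 \<Longrightarrow> 
        expectation (\<lambda>\<omega>. (Y i (t + d) \<omega> - Y i t \<omega> - \<nu> i * (B i (t + d) \<omega> - B i t \<omega>)) ^ 4) \<le> K i * d ^ 4"
  shows "square_integrable M (rho_estimator h \<nu> \<Delta> Y n)" (is ?sq)
    and "n > 0 \<Longrightarrow> expectation (\<lambda>\<omega>. (rho_estimator h \<nu> \<Delta> Y n \<omega> - \<rho>)\<^sup>2) \<le>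
      4 * ((\<Sum>m<n. cov_decay m) / real n) + 2 / (\<nu> 1 * \<nu> 2)\<^sup>2 * error_bound (\<nu> 1) (\<nu> 2) (K 1) (K 2) (\<Delta> n)"
proof -
  define \<delta> where "\<delta> = \<Delta> n"
  have \<delta>: "0 < \<delta>" "\<delta> \<le> d0" using d by (auto simp: \<delta>_def)
  define b where "b i k \<omega> = B i (real (k + 1) * \<delta>) \<omega> - B i (real k * \<delta>) \<omega>" for i k \<omega>
  define y where "y i k \<omega> = Y i (real (k + 1) * \<delta>) \<omega> - Y i (real k * \<delta>) \<omega>" for i k \<omega>
  define r where "r i k \<omega> = y i k \<omega> - \<nu> i * b i k \<omega>" for i k \<omega>
  have i1: "1 \<in> {1, 2 :: nat}" and i2: "2 \<in> {1, 2 :: nat}" by auto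
  have step: "real (k + 1) * \<delta> = real k * \<delta> + \<delta>" for k by (simp add: algebra_simps)
  have b_meas: "b i k \<in> borel_measurable M" if "i \<in> {1, 2}" for i k
    unfolding b_def[abs_def] by (intro borel_measurable_diff B_measurable that)
  have y_meas: "y i k \<in> borel_measurable M" if "i \<in> {1, 2}" for i k
    unfolding y_def[abs_def] by (intro borel_measurable_diff Y that)
  have r_meas: "r i k \<in> borel_measurable M" if "i \<in> {1, 2}" for i k
    unfolding r_def[abs_def] using b_meas[OF that] y_meas[OF that] by measurable
  have b4: "integrable M (\<lambda>\<omega>. b i k \<omega> ^ 4)" "expectation (\<lambda>\<omega>. b i k \<omega> ^ 4) \<le> 3 * \<delta> powr (4 * h i)"
    if "i \<in> {1, 2}" for i k
    unfolding b_def step increment_fourth_moment(2)[OF that] using \<delta>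
    by (simp_all add: increment_fourth_moment(1)[OF that])
  have r4: "integrable M (\<lambda>\<omega>. r i k \<omega> ^ 4)" "expectation (\<lambda>\<omega>. r i k \<omega> ^ 4) \<le> K i * \<delta> ^ 4"
    if "i \<in> {1, 2}" for i k
    unfolding r_def y_def b_def step by (rule res[OF that \<delta>])+
  have y4: "integrable M (\<lambda>\<omega>. y i k \<omega> ^ 4)" if "i \<in> {1, 2}" for i k
  proof -
    have eq: "y i k \<omega> = r i k \<omega> + \<nu> i * b i k \<omega>" for \<omega> by (simp add: r_def)
    show ?thesis unfolding eq
      by (rule integrable_power4_add)
        (use r_meas[OF that] b_meas[OF that] r4[OF that] b4[OF that] in \<open>auto simp: power_mult_distrib\<close>)
  qed
  define P where "P = \<delta> powr (h 1 + h 2)"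
  have P: "P > 0" using \<delta> by (simp add: P_def)
  have est: "rho_estimator h \<nu> \<Delta> Y n = (\<lambda>\<omega>. 1 / (\<nu> 1 * \<nu> 2 * real n * P) * (\<Sum>k<n. y 1 k \<omega> * y 2 k \<omega>))"
    by (rule ext) (simp add: rho_estimator_def y_def P_def \<delta>_def)
  show ?sq
    unfolding est by (intro square_integrable_scale square_integrable_sum square_integrable_mult(1) y_meas y4) auto
  assume n: "n > 0"
  \<comment> \<open>All terms of the product of the two increments of Y except \<nu>_1 \<nu>_2 b1
    b2.\<close>
  define e where "e k \<omega> = \<nu> 1 * (b 1 k \<omega> * r 2 k \<omega>) + \<nu> 2 * (b 2 k \<omega> * r 1 k \<omega>) + r 1 k \<omega> * r 2 k \<omega>" for k \<omega>
  have e: "square_integrable M (e k)"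
    "expectation (\<lambda>\<omega>. (e k \<omega>)\<^sup>2) \<le> P\<^sup>2 * error_bound (\<nu> 1) (\<nu> 2) (K 1) (K 2) \<delta>" for k
    unfolding e_def[abs_def] P_def
    by (rule product_error_bound[OF \<delta>(1) K[OF i1] K[OF i2] b_meas[OF i1] b_meas[OF i2] r_meas[OF i1] r_meas[OF i2]
      b4(1)[OF i1] b4(1)[OF i2] b4(2)[OF i1] b4(2)[OF i2] r4(1)[OF i1] r4(1)[OF i2] r4(2)[OF i1] r4(2)[OF i2]])+
  define X where "X \<omega> = ((\<Sum>k<n. b 1 k \<omega> * b 2 k \<omega>) - real n * (\<rho> * P)) / (real n * P)" for \<omega>
  define W where "W \<omega> = (\<Sum>k<n. e k \<omega>) / (\<nu> 1 * \<nu> 2 * real n * P)" for \<omega>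
  have intX: "integrable M (\<lambda>\<omega>. (X \<omega>)\<^sup>2)"
    using variance_increment_products(1)[OF \<delta>(1), of n] unfolding X_def power_divide b_def P_def by simp
  have "expectation (\<lambda>\<omega>. (X \<omega>)\<^sup>2) \<le> P\<^sup>2 * (real n * (2 * (\<Sum>m<n. cov_decay m))) / (real n * P)\<^sup>2"
    using variance_increment_products(2)[OF \<delta>(1), of n] unfolding X_def power_divide b_def P_def
    by (simp add: divide_right_mono)
  also have "\<dots> = 2 * ((\<Sum>m<n. cov_decay m) / real n)"
    using n P by (simp add: field_simps power2_eq_square)
  finally have EX: "expectation (\<lambda>\<omega>. (X \<omega>)\<^sup>2) \<le> 2 * ((\<Sum>m<n. cov_decay m) / real n)" .
  have int_e: "integrable M (\<lambda>\<omega>. (e k \<omega>)\<^sup>2)" for k using e(1) by (simp add: square_integrable_def)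
  have int_se: "integrable M (\<lambda>\<omega>. (\<Sum>k<n. e k \<omega>)\<^sup>2)"
    using square_integrable_sum[of "{..<n}" e] e(1) by (simp add: square_integrable_def)
  then have intW: "integrable M (\<lambda>\<omega>. (W \<omega>)\<^sup>2)" unfolding W_def power_divide by simp
  \<comment> \<open>No decorrelation between the remainder products is exploited: each is already
    small relative to P, and the factor n^2 from this crude bound is exactly what the normalization
    removes.\<close>
  have "expectation (\<lambda>\<omega>. (\<Sum>k<n. e k \<omega>)\<^sup>2) \<le> expectation (\<lambda>\<omega>. (\<Sum>k<n. (e k \<omega>)\<^sup>2) * real n)"
  proof (rule integral_mono[OF int_se])
    show "integrable M (\<lambda>\<omega>. (\<Sum>k<n. (e k \<omega>)\<^sup>2) * real n)"
      by (intro integrable_mult_left Bochner_Integration.integrable_sum int_e)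
    show "(\<Sum>k<n. e k \<omega>)\<^sup>2 \<le> (\<Sum>k<n. (e k \<omega>)\<^sup>2) * real n" for \<omega>
      using sum_squared_le_sum_of_squares[of "\<lambda>k. e k \<omega>" "{..<n}"] by simp
  qed
  also have "\<dots> = (\<Sum>k<n. expectation (\<lambda>\<omega>. (e k \<omega>)\<^sup>2)) * real n"
    using int_e by (simp add: Bochner_Integration.integral_sum)
  also have "\<dots> \<le> (\<Sum>k<n. P\<^sup>2 * error_bound (\<nu> 1) (\<nu> 2) (K 1) (K 2) \<delta>) * real n"
    by (intro mult_right_mono sum_mono e) auto
  also have "\<dots> = (real n * P)\<^sup>2 * error_bound (\<nu> 1) (\<nu> 2) (K 1) (K 2) \<delta>"
    by (simp add: power2_eq_square)
  finally have se: "expectation (\<lambda>\<omega>. (\<Sum>k<n. e k \<omega>)\<^sup>2) \<le> (real n * P)\<^sup>2 * error_bound (\<nu> 1) (\<nu> 2) (K 1) (K 2) \<delta>" .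
  have "expectation (\<lambda>\<omega>. (W \<omega>)\<^sup>2) = expectation (\<lambda>\<omega>. (\<Sum>k<n. e k \<omega>)\<^sup>2) / (\<nu> 1 * \<nu> 2 * real n * P)\<^sup>2"
    unfolding W_def power_divide by simp
  also have "\<dots> \<le> (real n * P)\<^sup>2 * error_bound (\<nu> 1) (\<nu> 2) (K 1) (K 2) \<delta> / (\<nu> 1 * \<nu> 2 * real n * P)\<^sup>2"
    by (rule divide_right_mono[OF se]) simp
  also have "\<dots> = 1 / (\<nu> 1 * \<nu> 2)\<^sup>2 * error_bound (\<nu> 1) (\<nu> 2) (K 1) (K 2) \<delta>"
    using n P \<nu> by (simp add: power_mult_distrib field_simps)
  finally have EW: "expectation (\<lambda>\<omega>. (W \<omega>)\<^sup>2) \<le> 1 / (\<nu> 1 * \<nu> 2)\<^sup>2 * error_bound (\<nu> 1) (\<nu> 2) (K 1) (K 2) \<delta>" .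
  have split: "rho_estimator h \<nu> \<Delta> Y n \<omega> - \<rho> = X \<omega> + W \<omega>" for \<omega>
  proof -
    have "y 1 k \<omega> * y 2 k \<omega> = \<nu> 1 * \<nu> 2 * (b 1 k \<omega> * b 2 k \<omega>) + e k \<omega>" for k
      by (simp add: e_def r_def algebra_simps)
    then have "(\<Sum>k<n. y 1 k \<omega> * y 2 k \<omega>) = \<nu> 1 * \<nu> 2 * (\<Sum>k<n. b 1 k \<omega> * b 2 k \<omega>) + (\<Sum>k<n. e k \<omega>)"
      by (simp add: sum.distrib sum_distrib_left)
    then show ?thesis
      unfolding est X_def W_def using n P \<nu> by (simp add: field_simps)
  qed
  have sqXW: "square_integrable M (\<lambda>\<omega>. rho_estimator h \<nu> \<Delta> Y n \<omega> + (- \<rho>))"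
    by (intro square_integrable_add square_integrable_const \<open>?sq\<close>)
  have "expectation (\<lambda>\<omega>. (rho_estimator h \<nu> \<Delta> Y n \<omega> - \<rho>)\<^sup>2) \<le> expectation (\<lambda>\<omega>. 2 * ((X \<omega>)\<^sup>2 + (W \<omega>)\<^sup>2))"
  proof (rule integral_mono)
    show "integrable M (\<lambda>\<omega>. (rho_estimator h \<nu> \<Delta> Y n \<omega> - \<rho>)\<^sup>2)"
      using sqXW by (simp add: square_integrable_def)
    show "integrable M (\<lambda>\<omega>. 2 * ((X \<omega>)\<^sup>2 + (W \<omega>)\<^sup>2))" using intX intW by simp
    show "(rho_estimator h \<nu> \<Delta> Y n \<omega> - \<rho>)\<^sup>2 \<le> 2 * ((X \<omega>)\<^sup>2 + (W \<omega>)\<^sup>2)" for \<omega>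
      unfolding split by (rule square_add_le)
  qed
  also have "\<dots> = 2 * (expectation (\<lambda>\<omega>. (X \<omega>)\<^sup>2) + expectation (\<lambda>\<omega>. (W \<omega>)\<^sup>2))" using intX intW by simp
  also have "\<dots> \<le> 2 * (2 * ((\<Sum>m<n. cov_decay m) / real n) + 1 / (\<nu> 1 * \<nu> 2)\<^sup>2 * error_bound (\<nu> 1) (\<nu> 2) (K 1) (K 2) \<delta>)"
    by (intro mult_left_mono add_mono EX EW) simp
  finally show "expectation (\<lambda>\<omega>. (rho_estimator h \<nu> \<Delta> Y n \<omega> - \<rho>)\<^sup>2) \<le>
      4 * ((\<Sum>m<n. cov_decay m) / real n) + 2 / (\<nu> 1 * \<nu> 2)\<^sup>2 * error_bound (\<nu> 1) (\<nu> 2) (K 1) (K 2) (\<Delta> n)"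
    by (simp add: \<delta>_def)
qed

end

theorem theorem6p2p13:
  fixes M :: "'w measure"
    and B Y :: "nat \<Rightarrow> real \<Rightarrow> 'w \<Rightarrow> real"
    and h \<alpha> \<nu> :: "nat \<Rightarrow> real"
    and \<rho> :: real
    and \<eta> :: "nat \<Rightarrow> nat \<Rightarrow> real"
    and \<Delta> :: "nat \<Rightarrow> real"
  assumes "prob_space M"
    and "\<forall>i\<in>{1, 2}. h i \<in> {0<..<1} - {1 / 2}"
    and "h 1 + h 2 \<noteq> 1"
    and "\<rho> \<in> {-1..1}"
    and "\<eta> 1 2 = - \<eta> 2 1"
    and "bivariate_fbm M h \<rho> \<eta> B"
    and "\<forall>i\<in>{1, 2}. \<alpha> i > 0 \<and> \<nu> i > 0"
    and "\<forall>i\<in>{1, 2}. fractional_ornstein_uhlenbeck M (\<alpha> i) (\<nu> i) (B i) (Y i)"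
    and "\<forall>n. \<Delta> n > 0"
    and "\<Delta> \<longlonglongrightarrow> 0"
    and "filterlim (\<lambda>n. real n * \<Delta> n) at_top sequentially"
  shows "converges_in_L2 M (rho_estimator h \<nu> \<Delta> Y) (\<lambda>\<omega>. \<rho>) \<and>
         converges_in_probability M (rho_estimator h \<nu> \<Delta> Y) (\<lambda>\<omega>. \<rho>)"
proof -
  interpret prob_space M by fact
  interpret bivariate_fbm_space M h \<rho> \<eta> B
    by unfold_locales (use assms(2,6) in auto)
  note \<alpha>\<nu> = assms(7)[rule_format] and ou = assms(8)[rule_format] and pos = assms(9)[rule_format]
  \<comment> \<open>A null sequence is bounded; with \<open>d0\<close> as a cap on all step sizes
    the residual constants do not depend on n.\<close>
  obtain d0 where "\<And>n. norm (\<Delta> n) \<le> d0"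
    using convergent_imp_Bseq[OF convergentI[OF assms(10)]] unfolding Bseq_def by blast
  then have d0: "\<Delta> n \<le> d0" for n using abs_le_D1 by fastforce
  have i12: "1 \<in> {1, 2 :: nat}" "2 \<in> {1, 2 :: nat}" by auto
  obtain K1 where K1: "K1 \<ge> 0"
    "\<And>t d. 0 < d \<Longrightarrow> d \<le> d0 \<Longrightarrow> integrable M (\<lambda>\<omega>. (Y 1 (t + d) \<omega> - Y 1 t \<omega> - \<nu> 1 * (B 1 (t + d) \<omega> - B 1 t \<omega>)) ^ 4)"
    "\<And>t d. 0 < d \<Longrightarrow> d \<le> d0 \<Longrightarrow> expectation (\<lambda>\<omega>. (Y 1 (t + d) \<omega> - Y 1 t \<omega> - \<nu> 1 * (B 1 (t + d) \<omega> - B 1 t \<omega>)) ^ 4) \<le> K1 * d ^ 4"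
    using residual_fourth_moment[OF i12(1) conjunct1[OF \<alpha>\<nu>[OF i12(1)]] ou[OF i12(1)]] by blast
  obtain K2 where K2: "K2 \<ge> 0"
    "\<And>t d. 0 < d \<Longrightarrow> d \<le> d0 \<Longrightarrow> integrable M (\<lambda>\<omega>. (Y 2 (t + d) \<omega> - Y 2 t \<omega> - \<nu> 2 * (B 2 (t + d) \<omega> - B 2 t \<omega>)) ^ 4)"
    "\<And>t d. 0 < d \<Longrightarrow> d \<le> d0 \<Longrightarrow> expectation (\<lambda>\<omega>. (Y 2 (t + d) \<omega> - Y 2 t \<omega> - \<nu> 2 * (B 2 (t + d) \<omega> - B 2 t \<omega>)) ^ 4) \<le> K2 * d ^ 4"
    using residual_fourth_moment[OF i12(2) conjunct1[OF \<alpha>\<nu>[OF i12(2)]] ou[OF i12(2)]] by blast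
  define K where "K i = (if i = 1 then K1 else K2)" for i :: nat
  have Y: "Y i t \<in> borel_measurable M" if "i \<in> {1, 2}" for i t
    using ou[OF that] by (auto simp: fractional_ornstein_uhlenbeck_def)
  have "K i \<ge> 0" if "i \<in> {1, 2}" for i using K1(1) K2(1) by (simp add: K_def)
  note err0 = rho_estimator_L2_error[where K=K and Y=Y and \<Delta>=\<Delta> and \<nu>=\<nu>, OF pos d0
      conjunct2[OF \<alpha>\<nu>[OF i12(1)]] conjunct2[OF \<alpha>\<nu>[OF i12(2)]] Y this]
  have res: "integrable M (\<lambda>\<omega>. (Y i (t + d) \<omega> - Y i t \<omega> - \<nu> i * (B i (t + d) \<omega> - B i t \<omega>)) ^ 4)"
    "expectation (\<lambda>\<omega>. (Y i (t + d) \<omega> - Y i t \<omega> - \<nu> i * (B i (t + d) \<omega> - B i t \<omega>)) ^ 4) \<le> K i * d ^ 4"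
    if "i \<in> {1, 2}" "0 < d" "d \<le> d0" for i t d
    using that K1 K2 by (auto simp: K_def)
  note err = err0[OF _ _ res]
  have "(\<lambda>n. 4 * ((\<Sum>m<n. cov_decay m) / real n) +
      2 / (\<nu> 1 * \<nu> 2)\<^sup>2 * error_bound (\<nu> 1) (\<nu> 2) (K 1) (K 2) (\<Delta> n)) \<longlonglongrightarrow> 4 * 0 + 2 / (\<nu> 1 * \<nu> 2)\<^sup>2 * 0"
    by (intro tendsto_intros cesaro_mean_tendsto_0 cov_decay_tendsto_0 error_bound_tendsto_0 pos assms(10))
      (simp add: cov_decay_def)
  then have lim0: "(\<lambda>n. 4 * ((\<Sum>m<n. cov_decay m) / real n) +
      2 / (\<nu> 1 * \<nu> 2)\<^sup>2 * error_bound (\<nu> 1) (\<nu> 2) (K 1) (K 2) (\<Delta> n)) \<longlonglongrightarrow> 0" by simp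
  have "(\<lambda>n. expectation (\<lambda>\<omega>. (rho_estimator h \<nu> \<Delta> Y n \<omega> - \<rho>)\<^sup>2)) \<longlonglongrightarrow> 0"
  proof (rule tendsto_sandwich[OF _ _ tendsto_const lim0])
    show "\<forall>\<^sub>F n in sequentially. expectation (\<lambda>\<omega>. (rho_estimator h \<nu> \<Delta> Y n \<omega> - \<rho>)\<^sup>2) \<le>
      4 * ((\<Sum>m<n. cov_decay m) / real n) + 2 / (\<nu> 1 * \<nu> 2)\<^sup>2 * error_bound (\<nu> 1) (\<nu> 2) (K 1) (K 2) (\<Delta> n)"
      \<comment> \<open>The error estimate holds for n > 0 only, so the sandwich is applied
        eventually.\<close>
      using eventually_gt_at_top[of 0] by eventually_elim (rule err(2))
  qed simp
  then have "converges_in_L2 M (rho_estimator h \<nu> \<Delta> Y) (\<lambda>\<omega>. \<rho>)"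
    unfolding converges_in_L2_def using err(1) square_integrable_const by blast
  then show ?thesis using converges_in_L2_imp_probability by blast
qed

end
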